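(* (i) There exists an (adaptive) algorithm with one-sided error that, given $0<\epsilon<1$, query access to $f\colon[3]\times[n]\to\mathbb{R}$ and sample access to an unknown distribution $\mathcal{D}$ on $[3]\times[n]$, accepts with probability $1$ if $f$ is convex and rejects with probability at least $2/3$ if $f$ is $\epsilon$-far from convex with respect to $\mathcal{D}$, using $O\!\left(\frac{\log^2 n}{\epsilon}\right)$ queries to $f$ and $O\!\left(\frac1\epsilon\right)$ samples from $\mathcal{D}$. (ii) There is a constant $\epsilon_0>0$ such that any non-adaptive $\epsilon_0$-tester for convexity of functions $f\colon[3]\times[n]\to\mathbb{R}$ (in the standard, uniform testing model) has query complexity $\Omega(\sqrt n)$.
   Context: $[m]=\{0,1,\dots,m-1\}$, and $[3]\times[n]\subseteq\mathbb{R}^2$. A function $f\colon X\to\mathbb{R}$ on a finite set $X\subseteq\mathbb{R}^d$ is convex if for every finite collection $x_1,\dots,x_k\in X$ and reals $\lambda_i\ge0$ with $\sum_i\lambda_i=1$ and $\sum_i\lambda_ix_i\in X$, one has $f(\sum_i\lambda_ix_i)\le\sum_i\lambda_if(x_i)$. $g$ is $\epsilon$-far from convex with respect to $\mathcal{D}$ if $\Pr_{x\sim\mathcal{D}}[g(x)\ne h(x)]\ge\epsilon$ for every convex $h$; in the standard model $\mathcal{D}$ is uniform, i.e. $g$ differs from every convex $h$ on at least $\epsilon|X|$ points. An $\epsilon$-tester is a randomized query algorithm accepting convex functions with probability at least $2/3$ and rejecting $\epsilon$-far functions with probability at least $2/3$; it is non-adaptive if all queries are chosen before any value is observed. *)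

theory Defs
  imports "HOL-Probability.Probability"
begin

definition grid :: "nat \<Rightarrow> (nat \<times> nat) set" where
  "grid n = {0..<3} \<times> {0..<n}"

definition emb :: "nat \<times> nat \<Rightarrow> real \<times> real" where
  "emb p = (real (fst p), real (snd p))"

definition convex_grid :: "nat \<Rightarrow> (nat \<times> nat \<Rightarrow> real) \<Rightarrow> bool" where
  "convex_grid n f \<longleftrightarrow>
     (\<forall>k (x :: nat \<Rightarrow> nat \<times> nat) (l :: nat \<Rightarrow> real) y.
        (\<forall>i<k. x i \<in> grid n \<and> l i \<ge> 0) \<and> (\<Sum>i<k. l i) = 1 \<and>
        y \<in> grid n \<and> emb y = (\<Sum>i<k. l i *\<^sub>R emb (x i))
        \<longrightarrow> f y \<le> (\<Sum>i<k. l i * f (x i)))"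

definition far_dist :: "nat \<Rightarrow> real \<Rightarrow> (nat \<times> nat) pmf \<Rightarrow> (nat \<times> nat \<Rightarrow> real) \<Rightarrow> bool" where
  "far_dist n \<epsilon> D g \<longleftrightarrow>
     (\<forall>h. convex_grid n h \<longrightarrow> measure_pmf.prob D {x. g x \<noteq> h x} \<ge> \<epsilon>)"

definition far_unif :: "nat \<Rightarrow> real \<Rightarrow> (nat \<times> nat \<Rightarrow> real) \<Rightarrow> bool" where
  "far_unif n \<epsilon> g \<longleftrightarrow>
     (\<forall>h. convex_grid n h \<longrightarrow>
        real (card {x \<in> grid n. g x \<noteq> h x}) \<ge> \<epsilon> * real (card (grid n)))"

text \<open>An algorithm is a (well-founded) decision tree: it may stop with a verdict
 (True = accept), query f at a point and continue depending on the answer, draw a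
 sample from D and continue depending on it, or flip a fair coin.\<close>
datatype alg =
    Decide bool
  | Query "nat \<times> nat" "real \<Rightarrow> alg"
  | Sample "nat \<times> nat \<Rightarrow> alg"
  | Coin "bool \<Rightarrow> alg"

primrec run :: "(nat \<times> nat \<Rightarrow> real) \<Rightarrow> (nat \<times> nat) pmf \<Rightarrow> alg \<Rightarrow> bool pmf" where
  "run f D (Decide b) = return_pmf b"
| "run f D (Query p k) = (run f D \<circ> k) (f p)"
| "run f D (Sample k) = bind_pmf D (run f D \<circ> k)"
| "run f D (Coin k) = bind_pmf (pmf_of_set UNIV) (run f D \<circ> k)"

inductive budget :: "nat \<Rightarrow> alg \<Rightarrow> nat \<Rightarrow> nat \<Rightarrow> bool" where
  "budget n (Decide b) q s"
| "p \<in> grid n \<Longrightarrow> (\<And>v. budget n (k v) q s) \<Longrightarrow> budget n (Query p k) (Suc q) s"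
| "(\<And>x. budget n (k x) q s) \<Longrightarrow> budget n (Sample k) q (Suc s)"
| "(\<And>b. budget n (k b) q s) \<Longrightarrow> budget n (Coin k) q s"
| "budget n A q s \<Longrightarrow> q \<le> q' \<Longrightarrow> s \<le> s' \<Longrightarrow> budget n A q' s'"

text \<open>A non-adaptive randomized algorithm is a distribution over pairs (query list,
 decision rule on the answers); all queries are fixed before any value is seen.\<close>
type_synonym na_alg = "((nat \<times> nat) list \<times> (real list \<Rightarrow> bool)) pmf"

definition na_accept_prob :: "na_alg \<Rightarrow> (nat \<times> nat \<Rightarrow> real) \<Rightarrow> real" where
  "na_accept_prob T f = measure_pmf.prob T {(qs, dec). dec (map f qs)}"

definition na_tester :: "nat \<Rightarrow> real \<Rightarrow> na_alg \<Rightarrow> bool" where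
  "na_tester n \<epsilon> T \<longleftrightarrow>
     (\<forall>f. convex_grid n f \<longrightarrow> na_accept_prob T f \<ge> 2/3) \<and>
     (\<forall>f. far_unif n \<epsilon> f \<longrightarrow> 1 - na_accept_prob T f \<ge> 2/3)"

definition na_queries_le :: "na_alg \<Rightarrow> nat \<Rightarrow> bool" where
  "na_queries_le T q \<longleftrightarrow> (\<forall>(qs, dec) \<in> set_pmf T. length qs \<le> q)"

end

theory Submission
  imports Defs
begin

text \<open>
  Upper bound. For a point \<open>x\<close>, query a set of \<open>O(log n)\<close> points and let \<open>x\<close> pass if the answers
  extend to a convex function. Rejection is then always justified, and it suffices that \<open>f\<close> restricted
  to the passing points extends to a convex function, i.e. has a supporting plane at each of them;
  \<open>2 / \<epsilon>\<close> sampled points then hit a failing one with probability at least \<open>2/3\<close>. Within a column, any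
  two points share a queried edge between them (dyadic intervals), and the slope on this edge
  separates their subgradients. For a point \<open>(1, y)\<close> one needs a subgradient \<open>b\<close> of the middle column
  at \<open>y\<close> together with points \<open>a\<close>, \<open>c\<close> of the outer columns at which \<open>b\<close> is also a subgradient:
  either \<open>a\<close>, \<open>c\<close> minimise \<open>f (0, a) + f (2, c)\<close> under \<open>a + c = 2 * y\<close>, or \<open>b\<close> is one of the two
  slopes of the middle column at \<open>y\<close>; all candidates are found by binary search.

  Lower bound. Hide a random shear \<open>r\<close>: convexity can only be violated on the collinear triples
  \<open>(0, y + r), (1, y), (2, y - r)\<close>, and a non-adaptive tester sees two points of one triple for at most
  \<open>q\<^sup>2\<close> of the \<open>n div 4\<close> values of \<open>r\<close>.
\<close>

section \<open>Convex functions on the grid\<close>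

text \<open>Averaging the plane at \<open>y\<close> over a convex combination with barycentre
  \<open>y\<close> returns \<open>f y\<close>, since the linear terms cancel. Every proof of
  \<open>convex_grid\<close> below goes through supporting planes.\<close>

lemma convex_gridI:
  assumes "\<And>y. y \<in> grid n \<Longrightarrow> \<exists>\<alpha> \<beta>. \<forall>x\<in>grid n.
    f y + \<alpha> * (real (fst x) - real (fst y)) + \<beta> * (real (snd x) - real (snd y)) \<le> f x"
  shows "convex_grid n f"
  unfolding convex_grid_def
proof (intro allI impI, elim conjE)
  fix k :: nat and x :: "nat \<Rightarrow> nat \<times> nat" and l :: "nat \<Rightarrow> real" and y
  assume x: "\<forall>i<k. x i \<in> grid n \<and> 0 \<le> l i" and l: "(\<Sum>i<k. l i) = 1" and y: "y \<in> grid n"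
    and e: "emb y = (\<Sum>i<k. l i *\<^sub>R emb (x i))"
  obtain \<alpha> \<beta> where supp: "\<forall>x\<in>grid n.
    f y + \<alpha> * (real (fst x) - real (fst y)) + \<beta> * (real (snd x) - real (snd y)) \<le> f x"
    using assms[OF y] by blast
  have e1: "real (fst y) = (\<Sum>i<k. l i * real (fst (x i)))"
    using arg_cong[OF e, of fst] by (simp add: emb_def fst_sum)
  have e2: "real (snd y) = (\<Sum>i<k. l i * real (snd (x i)))"
    using arg_cong[OF e, of snd] by (simp add: emb_def snd_sum)
  have "f y = f y * (\<Sum>i<k. l i)
      + \<alpha> * ((\<Sum>i<k. l i * real (fst (x i))) - (\<Sum>i<k. l i) * real (fst y))
      + \<beta> * ((\<Sum>i<k. l i * real (snd (x i))) - (\<Sum>i<k. l i) * real (snd y))"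
    unfolding l e1[symmetric] e2[symmetric] by simp
  also have "\<dots> = (\<Sum>i<k. l i * (f y + \<alpha> * (real (fst (x i)) - real (fst y))
      + \<beta> * (real (snd (x i)) - real (snd y))))"
    by (simp add: sum_distrib_left sum_distrib_right ring_distribs sum.distrib sum_subtractf mult_ac)
  also have "\<dots> \<le> (\<Sum>i<k. l i * f (x i))"
    using x supp by (intro sum_mono mult_left_mono) auto
  finally show "f y \<le> (\<Sum>i<k. l i * f (x i))" .
qed

text \<open>The only form in which \<open>convex_grid\<close> is exploited. One pair gives midpoint
  inequalities; two pairs with midpoints on either side of \<open>y\<close> serve the separation
  argument for slopes.\<close>

lemma convex_grid_two_pairs:
  assumes h: "convex_grid n h" and "0 \<le> \<kappa>" "0 \<le> \<mu>" "\<kappa> + \<mu> = 1"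
    and in_grid: "p \<in> grid n" "q \<in> grid n" "p' \<in> grid n" "q' \<in> grid n" "y \<in> grid n"
    and f: "\<kappa> * (real (fst p) + real (fst q)) + \<mu> * (real (fst p') + real (fst q')) = 2 * real (fst y)"
    and s: "\<kappa> * (real (snd p) + real (snd q)) + \<mu> * (real (snd p') + real (snd q')) = 2 * real (snd y)"
  shows "2 * h y \<le> \<kappa> * (h p + h q) + \<mu> * (h p' + h q')"
proof -
  define x where "x = (\<lambda>i::nat. if i = 0 then p else if i = 1 then q else if i = 2 then p' else q')"
  define l where "l = (\<lambda>i::nat. if i \<le> 1 then \<kappa> / 2 else \<mu> / 2)"
  have four: "{..<4::nat} = {0, 1, 2, 3}" by auto
  have "emb y = (\<Sum>i<4. l i *\<^sub>R emb (x i))"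
    using f s by (simp add: four l_def x_def emb_def prod_eq_iff algebra_simps)
  moreover have "(\<Sum>i<4. l i) = 1" using assms(4) by (simp add: four l_def)
  moreover have "\<forall>i<4. x i \<in> grid n \<and> 0 \<le> l i" using assms by (simp add: x_def l_def)
  ultimately have "h y \<le> (\<Sum>i<4. l i * h (x i))"
    using h in_grid(5) unfolding convex_grid_def by blast
  then show ?thesis by (simp add: four l_def x_def algebra_simps)
qed

section \<open>Convex sequences and dyadic certificates\<close>

text \<open>\<open>b\<close> is a subgradient of \<open>u\<close> at \<open>a\<close>, on the points
  below \<open>n\<close>.\<close>

definition supports :: "nat \<Rightarrow> (nat \<Rightarrow> real) \<Rightarrow> nat \<Rightarrow> real \<Rightarrow> bool" where
  "supports n u a b \<longleftrightarrow> (\<forall>z<n. u a + b * (real z - real a) \<le> u z)"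

definition convex_seq :: "nat \<Rightarrow> (nat \<Rightarrow> real) \<Rightarrow> bool" where
  "convex_seq n u \<longleftrightarrow> (\<forall>j. j + 2 < n \<longrightarrow> u (j + 1) - u j \<le> u (j + 2) - u (j + 1))"

lemma supportsD: "supports n u a b \<Longrightarrow> z < n \<Longrightarrow> u a + b * (real z - real a) \<le> u z"
  by (simp add: supports_def)

lemma convex_seq_slope_mono:
  assumes "convex_seq n u" "i \<le> j" "j + 1 < n"
  shows "u (i + 1) - u i \<le> u (j + 1) - u j"
  using assms(2,3)
proof (induction j rule: dec_induct)
  case (step j)
  have "u (j + 1) - u j \<le> u (j + 2) - u (j + 1)"
    using assms(1) step.prems by (auto simp: convex_seq_def)
  then show ?case using step by simp
qed simp

text \<open>Slopes increase, so only the two edges next to \<open>a\<close> matter; at an end of the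
  range the missing edge imposes no condition.\<close>

lemma supports_convex_seq:
  assumes cv: "convex_seq n u" and a: "a < n"
    and left: "0 < a \<Longrightarrow> u a - u (a - 1) \<le> b"
    and right: "a + 1 < n \<Longrightarrow> b \<le> u (a + 1) - u a"
  shows "supports n u a b"
  unfolding supports_def
proof (intro allI impI)
  fix z assume z: "z < n"
  have up: "u a + b * real d \<le> u (a + d)" if "a + d < n" for d
    using that
  proof (induction d)
    case (Suc d)
    have "b \<le> u (a + d + 1) - u (a + d)"
      using convex_seq_slope_mono[OF cv, of a "a + d"] right Suc.prems by force
    then show ?case using Suc by (simp add: algebra_simps)
  qed simp
  have down: "u a - b * real d \<le> u (a - d)" if "d \<le> a" for d
    using that
  proof (induction d)
    case (Suc d)
    have "u (a - Suc d + 1) - u (a - Suc d) \<le> u (a - 1 + 1) - u (a - 1)"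
      using Suc.prems a by (intro convex_seq_slope_mono[OF cv]) auto
    moreover have "a - Suc d + 1 = a - d" "a - 1 + 1 = a" using Suc.prems by auto
    ultimately have "u (a - d) - u (a - Suc d) \<le> b" using left Suc.prems by auto
    then show ?case using Suc by (simp add: algebra_simps)
  qed simp
  show "u a + b * (real z - real a) \<le> u z"
  proof (cases "a \<le> z")
    case True
    then show ?thesis using up[of "z - a"] z by simp
  next
    case False
    then show ?thesis using down[of "a - z"] by (simp add: algebra_simps)
  qed
qed

lemma supports_slope_le_right:
  assumes "supports n u a b" "a + 1 < n"
  shows "b \<le> u (a + 1) - u a"
  using supportsD[OF assms] by simp

lemma supports_slope_ge_left:
  assumes "supports n u a b" "0 < a" "a < n"
  shows "u a - u (a - 1) \<le> b"
  using supportsD[OF assms(1) less_imp_diff_less[OF assms(3)], of 1] assms(2) by simp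

lemma secant_supports:
  assumes "convex_seq n u" "0 < m" "m < n"
  shows "supports n u m (u m - u (m - 1))"
proof (rule supports_convex_seq[OF assms(1,3)])
  show "u m - u (m - 1) \<le> u (m + 1) - u m" if "m + 1 < n"
    using convex_seq_slope_mono[OF assms(1), of "m - 1" m] assms(2) that by simp
qed simp

text \<open>Two points are compared through an edge \<open>{m - 1, m}\<close> between them which both of their
  certificates contain: the slope across it separates the subgradients at the two points.\<close>

lemma transfer_right:
  assumes v: "convex_seq n v" "supports n v a b" and v': "convex_seq n v'"
    and m: "a < m" "m \<le> a'" "a' < n"
    and eq: "v (m - 1) = v' (m - 1)" "v m = v' m"
  shows "v a + b * (real a' - real a) \<le> v' a'"
proof -
  define s where "s = v m - v (m - 1)"
  have "v m + s * (real a - real m) \<le> v a"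
    using supportsD[OF secant_supports[OF v(1), of m], of a] m by (simp add: s_def)
  moreover have am: "v a + b * (real m - real a) \<le> v m"
    using supportsD[OF v(2), of m] m by simp
  ultimately have "(b - s) * (real m - real a) \<le> 0" by (simp add: algebra_simps)
  then have "b \<le> s" using m by (simp add: mult_le_0_iff)
  then have "b * (real a' - real m) \<le> s * (real a' - real m)"
    using m by (intro mult_right_mono) auto
  \<comment> \<open>\<open>v'\<close> agrees with \<open>v\<close> on the edge, so \<open>s\<close>
    is an edge slope of \<open>v'\<close> too and carries the bound from \<open>m\<close> on to
    \<open>a'\<close>.\<close>
  moreover have "v' m + s * (real a' - real m) \<le> v' a'"
    using supportsD[OF secant_supports[OF v', of m], of a'] m eq by (simp add: s_def)
  ultimately show ?thesis using am eq by (simp add: algebra_simps)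
qed

text \<open>The mirror image, anchored at \<open>m - 1\<close>, the end of the edge nearer to
  \<open>a'\<close>.\<close>

lemma transfer_left:
  assumes v: "convex_seq n v" "supports n v a b" and v': "convex_seq n v'"
    and m: "a' < m" "m \<le> a" "a < n"
    and eq: "v (m - 1) = v' (m - 1)" "v m = v' m"
  shows "v a + b * (real a' - real a) \<le> v' a'"
proof -
  define s where "s = v m - v (m - 1)"
  have "v m + s * (real a - real m) \<le> v a"
    using supportsD[OF secant_supports[OF v(1), of m], of a] m by (simp add: s_def)
  then have l: "v (m - 1) + s * (real a - real (m - 1)) \<le> v a"
    using m by (simp add: s_def algebra_simps)
  have am: "v a + b * (real (m - 1) - real a) \<le> v (m - 1)"
    using supportsD[OF v(2), of "m - 1"] m by simp
  have "(s - b) * (real a - real (m - 1)) \<le> 0" using l am by (simp add: algebra_simps)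
  then have "s \<le> b" using m by (simp add: mult_le_0_iff)
  then have "b * (real a' - real (m - 1)) \<le> s * (real a' - real (m - 1))"
    using m by (intro mult_right_mono_neg) auto
  moreover have "v' m + s * (real a' - real m) \<le> v' a'"
    using supportsD[OF secant_supports[OF v', of m], of a'] m eq by (simp add: s_def)
  then have "v' (m - 1) + s * (real a' - real (m - 1)) \<le> v' a'"
    using m eq by (simp add: s_def algebra_simps)
  ultimately show ?thesis using am eq by (simp add: algebra_simps)
qed

text \<open>The edges \<open>{m - 1, m}\<close> at both ends of the dyadic intervals that contain \<open>a\<close>.\<close>

definition dyadic :: "nat \<Rightarrow> nat \<Rightarrow> nat \<Rightarrow> nat list" where
  "dyadic n L a = filter (\<lambda>z. z < n) (concat (map (\<lambda>k.
     let m = a div 2 ^ k * 2 ^ k; m' = (a div 2 ^ k + 1) * 2 ^ k in [m - 1, m, m' - 1, m']) [0..<Suc L]))"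

lemma length_dyadic: "length (dyadic n L a) \<le> 4 * Suc L"
proof -
  have *: "length (concat (map (\<lambda>k. let m = a div 2 ^ k * 2 ^ k; m' = (a div 2 ^ k + 1) * 2 ^ k
      in [m - 1, m, m' - 1, m']) ks)) = 4 * length ks" for ks
    by (induction ks) (auto simp: Let_def)
  show ?thesis
    unfolding dyadic_def by (rule order_trans[OF length_filter_le]) (simp only: * length_upt diff_zero)
qed

lemma set_dyadic:
  "z \<in> set (dyadic n L a) \<longleftrightarrow> z < n \<and> (\<exists>k\<le>L.
     z \<in> {a div 2 ^ k * 2 ^ k - 1, a div 2 ^ k * 2 ^ k, (a div 2 ^ k + 1) * 2 ^ k - 1, (a div 2 ^ k + 1) * 2 ^ k})"
  unfolding dyadic_def Let_def set_filter set_concat set_map set_upt atLeast0LessThan lessThan_Suc_atMost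
  by auto

lemma dyadic_self: "a < n \<Longrightarrow> a \<in> set (dyadic n L a)"
  unfolding set_dyadic by (intro conjI exI[of _ 0]) auto

text \<open>Just below the first level at which both points share a dyadic interval, they lie in
  adjacent ones. The boundary \<open>m\<close> ends the interval of \<open>a\<close> and starts that
  of \<open>a'\<close>.\<close>

lemma dyadic_common:
  assumes "a < a'" "a' < n" "n \<le> 2 ^ L"
  obtains m where "a < m" "m \<le> a'"
    "{m - 1, m} \<subseteq> set (dyadic n L a)" "{m - 1, m} \<subseteq> set (dyadic n L a')"
proof -
  define P where "P k \<longleftrightarrow> a div 2 ^ k = a' div 2 ^ k" for k
  have PL: "P L" using assms by (simp add: P_def)
  define K where "K = (LEAST k. P k)"
  have PK: "P K" "K \<le> L" unfolding K_def using PL by (auto intro: LeastI Least_le)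
  have "\<not> P 0" using assms by (simp add: P_def)
  then obtain k where k: "K = Suc k" using PK by (cases K) auto
  have nPk: "\<not> P k" unfolding K_def using k not_less_Least[of k P] by (simp add: K_def)
  have le: "a div 2 ^ k \<le> a' div 2 ^ k" using assms by (intro div_le_mono) simp
  have "a div 2 ^ k div 2 = a' div 2 ^ k div 2"
    using PK(1) by (simp only: k P_def power_Suc2 div_mult2_eq)
  \<comment> \<open>Ordered, distinct quotients with equal halves are consecutive.\<close>
  then have step: "a' div 2 ^ k = a div 2 ^ k + 1"
    using nPk le unfolding P_def by linarith
  define m where "m = a' div 2 ^ k * 2 ^ k"
  have m': "m = (a div 2 ^ k + 1) * 2 ^ k" by (simp add: m_def step)
  have kL: "k \<le> L" using PK k by simp
  have "a < m"
    using dividend_less_div_times[of "2 ^ k" a] by (simp add: m')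
  moreover have ma: "m \<le> a'" by (simp add: m_def)
  moreover have "{m - 1, m} \<subseteq> set (dyadic n L a)"
    using kL ma assms(2) unfolding m' by (auto simp only: set_dyadic)
  moreover have "{m - 1, m} \<subseteq> set (dyadic n L a')"
    using kL ma assms(2) unfolding m_def by (auto simp only: set_dyadic)
  ultimately show ?thesis by (rule that)
qed

text \<open>\<open>v\<close> and \<open>v'\<close> are separate witnesses, each tied to
  \<open>u\<close> only on its own certificate. The common edge links them, so a subgradient of
  \<open>v\<close> at \<open>a\<close> bounds values of \<open>u\<close> alone.\<close>

lemma certified_transfer:
  assumes "n \<le> 2 ^ L" "a < n" "a' < n"
    and v: "convex_seq n v" "\<And>z. z \<in> set (dyadic n L a) \<Longrightarrow> v z = u z" "supports n v a b"
    and v': "convex_seq n v'" "\<And>z. z \<in> set (dyadic n L a') \<Longrightarrow> v' z = u z"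
  shows "u a + b * (real a' - real a) \<le> u a'"
proof -
  have e: "v a = u a" "v' a' = u a'" using v v' dyadic_self assms(2,3) by auto
  consider "a = a'" | "a < a'" | "a' < a" by linarith
  then show ?thesis
  proof cases
    case 2
    then obtain m where m: "a < m" "m \<le> a'"
      "{m - 1, m} \<subseteq> set (dyadic n L a)" "{m - 1, m} \<subseteq> set (dyadic n L a')"
      using dyadic_common assms by metis
    have "v a + b * (real a' - real a) \<le> v' a'"
      using m assms(3) v(2) v'(2) by (intro transfer_right[OF v(1,3) v'(1), where m = m]) auto
    then show ?thesis using e by simp
  next
    case 3
    then obtain m where m: "a' < m" "m \<le> a"
      "{m - 1, m} \<subseteq> set (dyadic n L a)" "{m - 1, m} \<subseteq> set (dyadic n L a')"
      using dyadic_common assms by metis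
    have "v a + b * (real a' - real a) \<le> v' a'"
      using m assms(2) v(2) v'(2) by (intro transfer_left[OF v(1,3) v'(1), where m = m]) auto
    then show ?thesis using e by simp
  qed simp
qed

section \<open>Supporting planes in the middle column\<close>

lemma convex_grid_column:
  assumes "convex_grid n h" "c < 3"
  shows "convex_seq n (\<lambda>z. h (c, z))"
  unfolding convex_seq_def
proof (intro allI impI)
  fix j assume "j + 2 < n"
  then have "2 * h (c, j + 1) \<le> 1 * (h (c, j) + h (c, j + 2)) + 0 * (h (c, j) + h (c, j + 2))"
    using assms by (intro convex_grid_two_pairs) (auto simp: grid_def)
  then show "h (c, j + 1) - h (c, j) \<le> h (c, j + 2) - h (c, j + 1)" by simp
qed

lemma real_between_finite:
  fixes A B :: "real set"
  assumes "finite A" "finite B" "\<And>a b. a \<in> A \<Longrightarrow> b \<in> B \<Longrightarrow> a \<le> b"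
  obtains x where "\<And>a. a \<in> A \<Longrightarrow> a \<le> x" "\<And>b. b \<in> B \<Longrightarrow> x \<le> b"
proof (cases "A = {}")
  case True
  show thesis
  proof (cases "B = {}")
    case False
    then show thesis using that[of "Min B"] True assms by auto
  qed (use True that in auto)
next
  case False
  then show thesis using that[of "Max A"] assms by auto
qed

text \<open>Each pair with midpoint in the middle column imposes a condition
  \<open>b * t \<le> w\<close> on the slope. Lower bounds come from \<open>t < 0\<close>, upper ones
  from \<open>t > 0\<close>, and convexity at \<open>(1, y)\<close> makes any two of them
  compatible.\<close>

lemma supporting_slope_exists:
  assumes h: "convex_grid n h" and y: "y < n"
  obtains b where "\<And>p q. p \<in> grid n \<Longrightarrow> q \<in> grid n \<Longrightarrow> fst p + fst q = 2 \<Longrightarrow>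
    2 * h (1, y) + b * (real (snd p) + real (snd q) - 2 * real y) \<le> h p + h q"
proof -
  define I where "I = {(p, q). p \<in> grid n \<and> q \<in> grid n \<and> fst p + fst q = 2}"
  \<comment> \<open>\<open>t\<close> is twice the displacement of the midpoint of the pair from
    \<open>y\<close>, and \<open>w\<close> twice the excess of its mean value over
    \<open>h (1, y)\<close>.\<close>
  define t where "t = (\<lambda>(p::nat\<times>nat, q::nat\<times>nat). real (snd p) + real (snd q) - 2 * real y)"
  define w where "w = (\<lambda>(p, q). h p + h q - 2 * h (1, y))"
  have "finite I" by (rule finite_subset[of _ "grid n \<times> grid n"]) (auto simp: I_def grid_def)
  have conv: "0 \<le> \<kappa> * w i + \<mu> * w j"
    if "i \<in> I" "j \<in> I" "0 \<le> \<kappa>" "0 \<le> \<mu>" "\<kappa> + \<mu> = 1" "\<kappa> * t i + \<mu> * t j = 0" for i j \<kappa> \<mu>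
  proof -
    obtain p q p' q' where ij: "i = (p, q)" "j = (p', q')" by (cases i, cases j)
    have fs: "real (fst p) + real (fst q) = 2" "real (fst p') + real (fst q') = 2"
      using that(1,2) by (auto simp: I_def ij simp flip: of_nat_add)
    have \<mu>: "\<mu> = 1 - \<kappa>" using that(5) by simp
    have "2 * h (1, y) \<le> \<kappa> * (h p + h q) + \<mu> * (h p' + h q')"
    proof (rule convex_grid_two_pairs[OF h that(3-5)])
      show "\<kappa> * (real (fst p) + real (fst q)) + \<mu> * (real (fst p') + real (fst q'))
          = 2 * real (fst (1::nat, y))"
        unfolding fs \<mu> by simp
      show "\<kappa> * (real (snd p) + real (snd q)) + \<mu> * (real (snd p') + real (snd q'))
          = 2 * real (snd (1::nat, y))"
        using that(6) unfolding \<mu> by (simp add: t_def ij algebra_simps)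
    qed (use that y in \<open>auto simp: I_def ij grid_def\<close>)
    then show ?thesis unfolding \<mu> by (simp add: w_def ij algebra_simps)
  qed
  obtain b where b: "\<And>x. x \<in> (\<lambda>i. w i / t i) ` {i \<in> I. t i < 0} \<Longrightarrow> x \<le> b"
    "\<And>x. x \<in> (\<lambda>i. w i / t i) ` {i \<in> I. 0 < t i} \<Longrightarrow> b \<le> x"
  proof (rule real_between_finite[of "(\<lambda>i. w i / t i) ` {i \<in> I. t i < 0}" "(\<lambda>i. w i / t i) ` {i \<in> I. 0 < t i}"])
    fix x x' assume "x \<in> (\<lambda>i. w i / t i) ` {i \<in> I. t i < 0}" "x' \<in> (\<lambda>i. w i / t i) ` {i \<in> I. 0 < t i}"
    then obtain i j where i: "i \<in> I" "t i < 0" "x = w i / t i" and j: "j \<in> I" "0 < t j" "x' = w j / t j"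
      by blast
    define d where "d = t j - t i"
    have d: "0 < d" using i j by (simp add: d_def)
    \<comment> \<open>These weights make the two displacements cancel.\<close>
    have "0 \<le> t j / d * w i + (- t i) / d * w j"
    proof (rule conv[OF i(1) j(1)])
      show "t j / d + (- t i) / d = 1" using d by (simp add: d_def flip: diff_divide_distrib)
    qed (use i j d in \<open>auto simp: divide_le_0_iff\<close>)
    then have "0 \<le> t j * w i - t i * w j" using d by (simp add: field_simps)
    then show "x \<le> x'" unfolding i(3) j(3) using i(2) j(2) by (simp add: field_simps)
  qed (use \<open>finite I\<close> in auto)
  have bI: "b * t i \<le> w i" if i: "i \<in> I" for i
  proof -
    consider "t i < 0" | "t i = 0" | "0 < t i" by linarith
    then show ?thesis
    proof cases
      case 1
      then have "w i / t i \<le> b" using b(1) i by blast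
      then show ?thesis using 1 by (simp add: field_simps)
    next
      case 2
      then show ?thesis using conv[OF i i, of 1 0] by simp
    next
      case 3
      then have "b \<le> w i / t i" using b(2) i by blast
      then show ?thesis using 3 by (simp add: field_simps)
    qed
  qed
  have "2 * h (1, y) + b * (real (snd p) + real (snd q) - 2 * real y) \<le> h p + h q"
    if "p \<in> grid n" "q \<in> grid n" "fst p + fst q = 2" for p q
    using bI[of "(p, q)"] that by (simp add: I_def t_def w_def)
  then show thesis by (rule that)
qed

text \<open>These \<open>b\<close> are the column slopes of supporting planes at
  \<open>(1, y)\<close>. The second clause results from eliminating the slope across the columns:
  \<open>a\<close> bounds it from below, \<open>c\<close> from above.\<close>

definition mid_supports :: "nat \<Rightarrow> (nat \<times> nat \<Rightarrow> real) \<Rightarrow> nat \<Rightarrow> real \<Rightarrow> bool" where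
  "mid_supports n h y b \<longleftrightarrow> supports n (\<lambda>z. h (1, z)) y b \<and>
     (\<forall>a<n. \<forall>c<n. 2 * h (1, y) + b * (real a + real c - 2 * real y) \<le> h (0, a) + h (2, c))"

lemma mid_supports_exists:
  assumes "convex_grid n h" "y < n"
  obtains b where "mid_supports n h y b"
proof -
  obtain b where b: "\<And>p q. p \<in> grid n \<Longrightarrow> q \<in> grid n \<Longrightarrow> fst p + fst q = 2 \<Longrightarrow>
    2 * h (1, y) + b * (real (snd p) + real (snd q) - 2 * real y) \<le> h p + h q"
    using supporting_slope_exists[OF assms] by blast
  have "mid_supports n h y b"
    unfolding mid_supports_def supports_def
  proof (intro conjI allI impI)
    fix z assume "z < n"
    then show "h (1, y) + b * (real z - real y) \<le> h (1, z)"
      using b[of "(1, z)" "(1, z)"] by (simp add: grid_def algebra_simps)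
  next
    fix a c assume "a < n" "c < n"
    then show "2 * h (1, y) + b * (real a + real c - 2 * real y) \<le> h (0, a) + h (2, c)"
      using b[of "(0, a)" "(2, c)"] by (simp add: grid_def)
  qed
  then show thesis by (rule that)
qed

text \<open>The slope \<open>b1\<close> is a multiplier for minimising \<open>h (0, a) + h (2, c)\<close> under \<open>a + c = 2 * y\<close>.
  If it is not a subgradient of the middle column at \<open>y\<close>, then the endpoint of the
  subdifferential nearest to \<open>b1\<close> works.\<close>

lemma mid_supports_candidate:
  assumes h: "convex_grid n h" and y: "y < n"
    and a: "a < n" "c < n" "a + c = 2 * y"
    and opt: "\<And>j i. j < n \<Longrightarrow> i < n \<Longrightarrow> j + i = 2 * y \<Longrightarrow> h (0, a) + h (2, c) \<le> h (0, j) + h (2, i)"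
  obtains b where "mid_supports n h y b"
    "supports n (\<lambda>z. h (0, z)) a b \<and> supports n (\<lambda>z. h (2, z)) c b
     \<or> y + 1 < n \<and> b = h (1, y + 1) - h (1, y)
     \<or> 0 < y \<and> b = h (1, y) - h (1, y - 1)"
proof -
  note cv = convex_grid_column[OF h]
  have cv0: "convex_seq n (\<lambda>z. h (0, z))" and cv1: "convex_seq n (\<lambda>z. h (1, z))"
    and cv2: "convex_seq n (\<lambda>z. h (2, z))" by (simp_all add: cv)
  obtain b where b: "mid_supports n h y b" using mid_supports_exists[OF h y] .
  have bsupp: "supports n (\<lambda>z. h (1, z)) y b" using b by (simp add: mid_supports_def)
  define Lo where "Lo = (if 0 < a then {h (0, a) - h (0, a - 1)} else {}) \<union> (if 0 < c then {h (2, c) - h (2, c - 1)} else {})"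
  define Up where "Up = (if a + 1 < n then {h (0, a + 1) - h (0, a)} else {}) \<union> (if c + 1 < n then {h (2, c + 1) - h (2, c)} else {})"
  have finite_bounds: "finite Lo" "finite Up" by (simp_all add: Lo_def Up_def)
  obtain b1 where b1: "\<And>l. l \<in> Lo \<Longrightarrow> l \<le> b1" "\<And>u. u \<in> Up \<Longrightarrow> b1 \<le> u"
  proof (rule real_between_finite[of Lo Up])
    have 1: "h (0, a) - h (0, a - 1) \<le> h (0, a + 1) - h (0, a)" if "0 < a" "a + 1 < n"
      using convex_seq_slope_mono[OF cv0, of "a - 1" a] that by simp
    have 2: "h (2, c) - h (2, c - 1) \<le> h (2, c + 1) - h (2, c)" if "0 < c" "c + 1 < n"
      using convex_seq_slope_mono[OF cv2, of "c - 1" c] that by simp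
    \<comment> \<open>Lowering \<open>a\<close> and raising \<open>c\<close> by one preserves
      \<open>a + c\<close>, so optimality compares the left slope of one column with the right slope
      of the other.\<close>
    have 3: "h (0, a) - h (0, a - 1) \<le> h (2, c + 1) - h (2, c)" if "0 < a" "c + 1 < n"
      using opt[OF less_imp_diff_less[OF a(1), of 1] that(2)] a(3) that(1) by simp
    have 4: "h (2, c) - h (2, c - 1) \<le> h (0, a + 1) - h (0, a)" if "0 < c" "a + 1 < n"
      using opt[OF that(2) less_imp_diff_less[OF a(2), of 1]] a(3) that(1) by simp
    show "l \<le> u" if "l \<in> Lo" "u \<in> Up" for l u
      using that 1 2 3 4 by (auto simp: Lo_def Up_def split: if_splits)
  qed (use finite_bounds in auto)
  have s0: "supports n (\<lambda>z. h (0, z)) a b1"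
    using b1 a by (intro supports_convex_seq[OF cv0]) (auto simp: Lo_def Up_def)
  have s2: "supports n (\<lambda>z. h (2, z)) c b1"
    using b1 a by (intro supports_convex_seq[OF cv2]) (auto simp: Lo_def Up_def)
  have opt_sum: "real a + real c = 2 * real y" using a(3) by linarith
  have mid: "2 * h (1, y) \<le> h (0, a) + h (2, c)"
    using opt_sum b a(1,2) unfolding mid_supports_def by (metis add.right_neutral diff_self mult_zero_right)
  have pair: "2 * h (1, y) + b1 * (real j + real i - 2 * real y) \<le> h (0, j) + h (2, i)"
    if "j < n" "i < n" for j i
  proof -
    have "b1 * (real j + real i - 2 * real y) = b1 * (real j - real a) + b1 * (real i - real c)"
      unfolding opt_sum[symmetric] by (simp add: algebra_simps)
    then show ?thesis
      using supportsD[OF s0 that(1)] supportsD[OF s2 that(2)] mid by linarith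
  qed
  \<comment> \<open>The condition is affine in the slope, so it passes from \<open>b\<close> and
    \<open>b1\<close> to every slope between them.\<close>
  have between: "2 * h (1, y) + x * (real j + real i - 2 * real y) \<le> h (0, j) + h (2, i)"
    if "j < n" "i < n" "min b b1 \<le> x" "x \<le> max b b1" for j i x
  proof -
    let ?t = "real j + real i - 2 * real y"
    have bt: "2 * h (1, y) + b * ?t \<le> h (0, j) + h (2, i)"
      using b that by (simp add: mid_supports_def)
    have "x * ?t \<le> max (b * ?t) (b1 * ?t)"
      using that(3,4) mult_right_mono[of x "max b b1" ?t] mult_right_mono_neg[of "min b b1" x ?t]
      by (cases "0 \<le> ?t") (auto simp: min_def max_def split: if_splits)
    then show ?thesis using bt pair[OF that(1,2)] by linarith
  qed
  consider "0 < y" "b1 < h (1, y) - h (1, y - 1)" | "y + 1 < n" "h (1, y + 1) - h (1, y) < b1"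
    | "0 < y \<longrightarrow> h (1, y) - h (1, y - 1) \<le> b1" "y + 1 < n \<longrightarrow> b1 \<le> h (1, y + 1) - h (1, y)"
    by linarith
  then show thesis
  proof cases
    case 1
    let ?x = "h (1, y) - h (1, y - 1)"
    \<comment> \<open>The left slope \<open>?x\<close> thus lies between \<open>b1\<close> and the
      subgradient \<open>b\<close>.\<close>
    have "?x \<le> b" using supports_slope_ge_left[OF bsupp 1(1) y] by simp
    then have "mid_supports n h y ?x"
      using 1 between secant_supports[OF cv1 1(1) y] by (auto simp: mid_supports_def)
    then show thesis using that 1 by blast
  next
    case 2
    let ?x = "h (1, y + 1) - h (1, y)"
    have "b \<le> ?x" using supports_slope_le_right[OF bsupp 2(1)] by simp
    moreover have "supports n (\<lambda>z. h (1, z)) y ?x"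
      using convex_seq_slope_mono[OF cv1, of "y - 1" y] 2
      by (intro supports_convex_seq[OF cv1 y]) auto
    ultimately have "mid_supports n h y ?x"
      using 2 between by (auto simp: mid_supports_def)
    then show thesis using that 2 by blast
  next
    case 3
    then have "supports n (\<lambda>z. h (1, z)) y b1"
      by (intro supports_convex_seq[OF cv1 y]) auto
    then have "mid_supports n h y b1" using pair by (auto simp: mid_supports_def)
    then show thesis using that s0 s2 by blast
  qed
qed

section \<open>The adaptive tester\<close>

text \<open>Deterministic adaptive programs with a result and no sampling. Unlike
  \<open>alg\<close>, they can be composed, and the points asked on a given \<open>f\<close> can be
  collected.\<close>

datatype 'a prog = Ret 'a | Ask "nat \<times> nat" "real \<Rightarrow> 'a prog"

primrec bind_prog :: "'a prog \<Rightarrow> ('a \<Rightarrow> 'b prog) \<Rightarrow> 'b prog" where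
  "bind_prog (Ret x) g = g x"
| "bind_prog (Ask p k) g = Ask p (\<lambda>v. bind_prog (k v) g)"

primrec result :: "(nat \<times> nat \<Rightarrow> real) \<Rightarrow> 'a prog \<Rightarrow> 'a" where
  "result f (Ret x) = x"
| "result f (Ask p k) = result f (k (f p))"

primrec queried :: "(nat \<times> nat \<Rightarrow> real) \<Rightarrow> 'a prog \<Rightarrow> (nat \<times> nat) set" where
  "queried f (Ret x) = {}"
| "queried f (Ask p k) = insert p (queried f (k (f p)))"

primrec cost_le :: "nat \<Rightarrow> 'a prog \<Rightarrow> nat \<Rightarrow> bool" where
  "cost_le n (Ret x) d \<longleftrightarrow> True"
| "cost_le n (Ask p k) d \<longleftrightarrow> p \<in> grid n \<and> 0 < d \<and> (\<forall>v. cost_le n (k v) (d - 1))"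

lemma result_bind [simp]: "result f (bind_prog P g) = result f (g (result f P))"
  by (induction P) auto

lemma queried_bind [simp]: "queried f (bind_prog P g) = queried f P \<union> queried f (g (result f P))"
  by (induction P) auto

lemma cost_le_mono: "cost_le n P d \<Longrightarrow> d \<le> e \<Longrightarrow> cost_le n P e"
proof (induction P arbitrary: d e)
  case (Ask p k)
  have "cost_le n (k v) (e - 1)" for v
    by (rule Ask.IH[of "k v" "d - 1"]) (use Ask.prems in auto)
  then show ?case using Ask.prems by auto
qed simp

lemma cost_le_bind:
  assumes "cost_le n P d" "\<And>x. cost_le n (g x) e"
  shows "cost_le n (bind_prog P g) (d + e)"
  using assms(1)
proof (induction P arbitrary: d)
  case (Ret x)
  then show ?case using assms(2) cost_le_mono[of n "g x" e "d + e"] by simp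
next
  case (Ask p k)
  have "cost_le n (bind_prog (k v) g) (d - 1 + e)" for v
    using Ask.prems by (intro Ask.IH) auto
  then show ?case using Ask.prems by (auto simp: Suc_diff_le)
qed

text \<open>Agreement on the queried points fixes the whole adaptive run. Hence a convex function
  matching the answers can stand in for \<open>f\<close>, and facts about searches on convex
  functions apply.\<close>

lemma cong_queried:
  assumes "\<And>p. p \<in> queried f P \<Longrightarrow> h p = f p"
  shows "result h P = result f P \<and> queried h P = queried f P"
  using assms by (induction P) auto

section \<open>Query lists and binary search\<close>

primrec ask_all :: "(nat \<times> nat) list \<Rightarrow> unit prog" where
  "ask_all [] = Ret ()"
| "ask_all (p # ps) = Ask p (\<lambda>_. ask_all ps)"

lemma queried_ask_all [simp]: "queried f (ask_all ps) = set ps"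
  by (induction ps) auto

lemma cost_le_ask_all: "set ps \<subseteq> grid n \<Longrightarrow> length ps \<le> d \<Longrightarrow> cost_le n (ask_all ps) d"
  by (induction ps arbitrary: d) auto

text \<open>The fuel \<open>k\<close> bounds the number of rounds even if the answers are not
  monotone.\<close>

primrec bsearch :: "(nat \<Rightarrow> bool prog) \<Rightarrow> nat \<Rightarrow> nat \<Rightarrow> nat \<Rightarrow> nat prog" where
  "bsearch P 0 lo hi = Ret lo"
| "bsearch P (Suc k) lo hi = (if lo < hi
     then bind_prog (P ((lo + hi) div 2)) (\<lambda>b. if b then bsearch P k lo ((lo + hi) div 2)
       else bsearch P k (Suc ((lo + hi) div 2)) hi)
     else Ret lo)"

lemma cost_le_bsearch:
  assumes "\<And>m. lo \<le> m \<Longrightarrow> m < hi \<Longrightarrow> cost_le n (P m) d"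
  shows "cost_le n (bsearch P k lo hi) (k * d)"
  using assms
proof (induction k arbitrary: lo hi)
  case (Suc k)
  let ?m = "(lo + hi) div 2"
  have "cost_le n (bsearch P (Suc k) lo hi) (d + k * d)" if "lo < hi"
  proof -
    have "cost_le n (P ?m) d" using that by (intro Suc.prems) auto
    moreover have "cost_le n (bsearch P k lo ?m) (k * d)" "cost_le n (bsearch P k (Suc ?m) hi) (k * d)"
      using that by (auto intro!: Suc.IH Suc.prems)
    ultimately show ?thesis using that by (auto intro!: cost_le_bind)
  qed
  then show ?case by (cases "lo < hi") auto
qed simp

text \<open>For a monotone test the result is the threshold, or \<open>hi\<close> if no position
  passes. Each round halves the length, so \<open>k\<close> rounds suffice below
  \<open>2 ^ k\<close>.\<close>

lemma result_bsearch:
  assumes "lo \<le> hi" "hi - lo < 2 ^ k"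
    and "\<And>i j. lo \<le> i \<Longrightarrow> i \<le> j \<Longrightarrow> j < hi \<Longrightarrow> result f (P i) \<Longrightarrow> result f (P j)"
  shows "result f (bsearch P k lo hi) \<in> {lo..hi} \<and>
    (\<forall>j. lo \<le> j \<and> j < hi \<longrightarrow> (result f (P j) \<longleftrightarrow> result f (bsearch P k lo hi) \<le> j))"
  using assms
proof (induction k arbitrary: lo hi)
  case 0
  then show ?case by auto
next
  case (Suc k)
  show ?case
  proof (cases "lo < hi")
    case True
    define m where "m = (lo + hi) div 2"
    have m: "lo \<le> m" "m < hi" "m - lo < 2 ^ k" "hi - Suc m < 2 ^ k"
      using True Suc.prems(2) by (auto simp: m_def)
    show ?thesis
    proof (cases "result f (P m)")
      case t: True
      let ?r = "result f (bsearch P k lo m)"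
      have IH: "?r \<in> {lo..m} \<and> (\<forall>j. lo \<le> j \<and> j < m \<longrightarrow> (result f (P j) \<longleftrightarrow> ?r \<le> j))"
        using m by (intro Suc.IH) (auto intro: Suc.prems(3))
      have "result f (P j) \<longleftrightarrow> ?r \<le> j" if "lo \<le> j" "j < hi" for j
      proof (cases "j < m")
        case False
        then have "result f (P j)" using Suc.prems(3)[of m j] m t that by simp
        then show ?thesis using IH False by auto
      qed (use IH that in auto)
      moreover have "?r \<in> {lo..hi}" using IH m by auto
      ultimately show ?thesis using True t by (simp flip: m_def)
    next
      case f: False
      let ?r = "result f (bsearch P k (Suc m) hi)"
      have IH: "?r \<in> {Suc m..hi} \<and> (\<forall>j. Suc m \<le> j \<and> j < hi \<longrightarrow> (result f (P j) \<longleftrightarrow> ?r \<le> j))"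
      proof (intro Suc.IH)
        show "result f (P j)" if "Suc m \<le> i" "i \<le> j" "j < hi" "result f (P i)" for i j
          using Suc.prems(3)[of i j] m that by simp
      qed (use m in auto)
      have "result f (P j) \<longleftrightarrow> ?r \<le> j" if "lo \<le> j" "j < hi" for j
      proof (cases "j \<le> m")
        case True
        then have "\<not> result f (P j)" using Suc.prems(3)[of j m] m f that by auto
        then show ?thesis using IH True by auto
      qed (use IH that in auto)
      moreover have "?r \<in> {lo..hi}" using IH m by auto
      ultimately show ?thesis using True f by (simp flip: m_def)
    qed
  qed (use Suc.prems in auto)
qed

text \<open>Convexity makes the descent test monotone; \<open>F\<close> decreases strictly up to the
  threshold and never decreases after it.\<close>

lemma bsearch_argmin:
  fixes F :: "nat \<Rightarrow> real"
  assumes le: "lo \<le> hi" "hi - lo < 2 ^ k"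
    and P: "\<And>m. lo \<le> m \<Longrightarrow> m < hi \<Longrightarrow> result f (P m) \<longleftrightarrow> F m \<le> F (m + 1)"
    and cv: "\<And>m. lo \<le> m \<Longrightarrow> m + 1 < hi \<Longrightarrow> F (m + 1) - F m \<le> F (m + 2) - F (m + 1)"
  defines "r \<equiv> result f (bsearch P k lo hi)"
  shows "r \<in> {lo..hi}" "\<And>j. j \<in> {lo..hi} \<Longrightarrow> F r \<le> F j"
proof -
  have mono: "F (i + 1) - F i \<le> F (j + 1) - F j" if "lo \<le> i" "i \<le> j" "j < hi" for i j
    using that(2,3)
  proof (induction j rule: dec_induct)
    case (step j)
    then show ?case using cv[of j] that(1) by simp
  qed simp
  have r: "r \<in> {lo..hi} \<and> (\<forall>j. lo \<le> j \<and> j < hi \<longrightarrow> (result f (P j) \<longleftrightarrow> r \<le> j))"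
    unfolding r_def
  proof (rule result_bsearch[OF le])
    show "result f (P j)" if "lo \<le> i" "i \<le> j" "j < hi" "result f (P i)" for i j
      using mono[OF that(1-3)] that P[of i] P[of j] by simp
  qed
  then show rin: "r \<in> {lo..hi}" by simp
  have up: "F r \<le> F j" if "r \<le> j" "j \<le> hi" for j
    using that
  proof (induction j rule: dec_induct)
    case (step j)
    then have "result f (P j)" using r by auto
    then show ?case using step P[of j] rin by auto
  qed simp
  have down: "F r \<le> F j" if "j \<le> r" "lo \<le> j" for j
    using that
  proof (induction j rule: inc_induct)
    case (step j)
    then have "\<not> result f (P j)" using r by auto
    then show ?case using step P[of j] rin by auto
  qed simp
  show "F r \<le> F j" if "j \<in> {lo..hi}" for j
    using up[of j] down[of j] that by (cases "r \<le> j") auto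
qed

section \<open>Query programs for certificates and for checking one point\<close>

definition cert :: "nat \<Rightarrow> nat \<Rightarrow> nat \<Rightarrow> nat \<Rightarrow> unit prog" where
  "cert n L c a = ask_all (map (Pair c) (dyadic n L a))"

text \<open>This is the descent test for \<open>f (c, m) - b * real m\<close>, whose minimisers are
  the points where \<open>b\<close> is a subgradient of the column.\<close>

definition slope_search :: "nat \<Rightarrow> nat \<Rightarrow> nat \<Rightarrow> real \<Rightarrow> nat prog" where
  "slope_search n L c b = bsearch (\<lambda>m. Ask (c, m) (\<lambda>v. Ask (c, m + 1) (\<lambda>w. Ret (b \<le> w - v)))) L 0 (n - 1)"

text \<open>Seeks a minimum of \<open>f (0, m) + f (2, 2 * y - m)\<close>; for \<open>y < n\<close>
  the bounds admit exactly the \<open>m\<close> with \<open>m\<close> and \<open>2 * y - m\<close>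
  both in range.\<close>

definition split_search :: "nat \<Rightarrow> nat \<Rightarrow> nat \<Rightarrow> nat prog" where
  "split_search n L y = bsearch (\<lambda>m. Ask (0, m) (\<lambda>v. Ask (0, m + 1) (\<lambda>v'.
     Ask (2, 2 * y - m) (\<lambda>w. Ask (2, 2 * y - (m + 1)) (\<lambda>w'. Ret (v + w \<le> v' + w'))))))
     L (2 * y - (n - 1)) (min (n - 1) (2 * y))"

definition slope_certs :: "nat \<Rightarrow> nat \<Rightarrow> real \<Rightarrow> unit prog" where
  "slope_certs n L b = bind_prog (slope_search n L 0 b) (\<lambda>a. bind_prog (cert n L 0 a) (\<lambda>_.
     bind_prog (slope_search n L 2 b) (cert n L 2)))"

definition split_certs :: "nat \<Rightarrow> nat \<Rightarrow> nat \<Rightarrow> unit prog" where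
  "split_certs n L y = bind_prog (split_search n L y) (\<lambda>a.
     bind_prog (cert n L 0 a) (\<lambda>_. cert n L 2 (2 * y - a)))"

definition edge_certs :: "nat \<Rightarrow> nat \<Rightarrow> nat \<Rightarrow> unit prog" where
  "edge_certs n L y = (if y + 1 < n
     then Ask (1, y) (\<lambda>v. Ask (1, y + 1) (\<lambda>w. slope_certs n L (w - v))) else Ret ())"

text \<open>At a middle point the split or either adjacent edge may supply the subgradient, so all
  three are certified. A sample outside the grid asks nothing, because \<open>budget\<close> ranges
  over all samples.\<close>

definition point_check :: "nat \<Rightarrow> nat \<Rightarrow> nat \<times> nat \<Rightarrow> unit prog" where
  "point_check n L x = (if x \<notin> grid n then Ret ()
     else bind_prog (cert n L (fst x) (snd x)) (\<lambda>_. if fst x \<noteq> 1 then Ret ()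
       else bind_prog (split_certs n L (snd x)) (\<lambda>_. bind_prog (edge_certs n L (snd x)) (\<lambda>_.
         if snd x = 0 then Ret () else edge_certs n L (snd x - 1)))))"

section \<open>Query costs\<close>

lemma queried_cert [simp]: "queried f (cert n L c a) = Pair c ` set (dyadic n L a)"
  by (simp add: cert_def)

lemma cost_le_cert: "c < 3 \<Longrightarrow> cost_le n (cert n L c a) (4 * Suc L)"
  unfolding cert_def
  by (intro cost_le_ask_all) (auto simp: set_dyadic grid_def length_dyadic[THEN order_trans])

lemma cost_le_slope_search: "c < 3 \<Longrightarrow> cost_le n (slope_search n L c b) (L * 2)"
  unfolding slope_search_def by (intro cost_le_bsearch) (auto simp: grid_def)

lemma cost_le_split_search: "cost_le n (split_search n L y) (L * 4)"
  unfolding split_search_def by (intro cost_le_bsearch) (auto simp: grid_def)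

lemma cost_le_slope_certs:
  "cost_le n (slope_certs n L b) (L * 2 + (4 * Suc L + (L * 2 + 4 * Suc L)))"
  unfolding slope_certs_def
  by (intro cost_le_bind cost_le_slope_search cost_le_cert) auto

lemma cost_le_edge_certs: "cost_le n (edge_certs n L y) (12 * L + 10)"
proof -
  have "cost_le n (slope_certs n L b) (8 + 12 * L)" for b
    using cost_le_slope_certs by (rule cost_le_mono) simp
  then show ?thesis by (auto simp: edge_certs_def grid_def)
qed

lemma cost_le_split_certs: "cost_le n (split_certs n L y) (L * 4 + (4 * Suc L + 4 * Suc L))"
  unfolding split_certs_def
  by (intro cost_le_bind cost_le_split_search cost_le_cert) auto

text \<open>The sum of \<open>4 * L + 4\<close> for the own certificate, \<open>12 * L + 8\<close>
  for the split and twice \<open>12 * L + 10\<close> for the edges.\<close>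

lemma cost_le_point_check: "cost_le n (point_check n L x) (40 * L + 32)"
proof (cases "x \<in> grid n")
  case True
  then have c: "fst x < 3" by (auto simp: grid_def)
  define rest where "rest = (\<lambda>_::unit. if snd x = 0 then Ret () else edge_certs n L (snd x - 1))"
  have "cost_le n (rest u) (12 * L + 10)" for u
    by (simp add: rest_def cost_le_edge_certs)
  then have mid: "cost_le n (bind_prog (split_certs n L (snd x)) (\<lambda>_. bind_prog (edge_certs n L (snd x)) rest))
      (L * 4 + (4 * Suc L + 4 * Suc L) + ((12 * L + 10) + (12 * L + 10)))"
    by (intro cost_le_bind cost_le_split_certs cost_le_edge_certs) auto
  have "cost_le n (bind_prog (cert n L (fst x) (snd x)) (\<lambda>_. if fst x \<noteq> 1 then Ret ()
       else bind_prog (split_certs n L (snd x)) (\<lambda>_. bind_prog (edge_certs n L (snd x)) rest)))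
      (4 * Suc L + (L * 4 + (4 * Suc L + 4 * Suc L) + ((12 * L + 10) + (12 * L + 10))))"
    using mid by (intro cost_le_bind cost_le_cert c) auto
  then have "cost_le n (point_check n L x)
      (4 * Suc L + (L * 4 + (4 * Suc L + 4 * Suc L) + ((12 * L + 10) + (12 * L + 10))))"
    unfolding point_check_def rest_def using True by (simp only: simp_thms if_False)
  then show ?thesis by (rule cost_le_mono) simp
qed (simp add: point_check_def)

section \<open>Outcome of the searches on convex functions\<close>

lemma slope_search_supports:
  fixes b :: real
  assumes "convex_seq n (\<lambda>z. h (c, z))" "0 < n" "n \<le> 2 ^ L"
  defines "r \<equiv> result h (slope_search n L c b)"
  shows "r < n" "supports n (\<lambda>z. h (c, z)) r b"
proof -
  let ?F = "\<lambda>m. h (c, m) - b * real m"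
  note m = bsearch_argmin[of 0 "n - 1" L h
      "\<lambda>m. Ask (c, m) (\<lambda>v. Ask (c, m + 1) (\<lambda>w. Ret (b \<le> w - v)))" ?F]
  have r: "r \<in> {0..n - 1}"
    unfolding r_def slope_search_def using assms(1-3)
    by (intro m) (auto simp: convex_seq_def algebra_simps)
  have *: "?F r \<le> ?F j" if "j \<in> {0..n - 1}" for j
    unfolding r_def slope_search_def using assms(1-3) that
    by (intro m) (auto simp: convex_seq_def algebra_simps)
  show "r < n" using r assms(2) by auto
  show "supports n (\<lambda>z. h (c, z)) r b"
    unfolding supports_def
  proof (intro allI impI)
    fix z assume "z < n"
    then show "h (c, r) + b * (real z - real r) \<le> h (c, z)"
      using *[of z] by (simp add: algebra_simps)
  qed
qed

lemma split_search_optimal: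
  assumes h: "convex_grid n h" and y: "y < n" and L: "n \<le> 2 ^ L"
  defines "r \<equiv> result h (split_search n L y)"
  shows "r < n" "r \<le> 2 * y" "2 * y - r < n"
    "\<And>j i. j < n \<Longrightarrow> i < n \<Longrightarrow> j + i = 2 * y \<Longrightarrow> h (0, r) + h (2, 2 * y - r) \<le> h (0, j) + h (2, i)"
proof -
  let ?F = "\<lambda>m. h (0, m) + h (2, 2 * y - m)"
  let ?lo = "2 * y - (n - 1)" and ?hi = "min (n - 1) (2 * y)"
  have cv: "?F (m + 1) - ?F m \<le> ?F (m + 2) - ?F (m + 1)" if "?lo \<le> m" "m + 1 < ?hi" for m
  proof -
    \<comment> \<open>Counting from \<open>i\<close> removes the truncated subtraction; the second
      column runs backwards, which preserves convexity.\<close>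
    define i where "i = 2 * y - (m + 2)"
    have i: "2 * y - (m + 1) = i + 1" "2 * y - m = i + 2" using that by (auto simp: i_def)
    have "h (0, m + 1) - h (0, m) \<le> h (0, m + 2) - h (0, m + 1)"
      using convex_grid_column[OF h, of 0] that by (auto simp: convex_seq_def)
    moreover have "h (2, i + 1) - h (2, i) \<le> h (2, i + 2) - h (2, i + 1)"
      using convex_grid_column[OF h, of 2] that i by (auto simp: convex_seq_def)
    ultimately show ?thesis unfolding i i_def[symmetric] by simp
  qed
  note m = bsearch_argmin[of ?lo ?hi L h "\<lambda>m. Ask (0, m) (\<lambda>v. Ask (0, m + 1) (\<lambda>v'.
     Ask (2, 2 * y - m) (\<lambda>w. Ask (2, 2 * y - (m + 1)) (\<lambda>w'. Ret (v + w \<le> v' + w')))))" ?F]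
  have lohi: "?lo \<le> ?hi" "?hi - ?lo < 2 ^ L" using y L by auto
  have r: "r \<in> {?lo..?hi}"
    unfolding r_def split_search_def by (rule m(1)[OF lohi _ cv]) simp_all
  show r': "r < n" "r \<le> 2 * y" "2 * y - r < n" using r y by auto
  fix j i assume ji: "j < n" "i < n" "j + i = 2 * y"
  then have "j \<in> {?lo..?hi}" by auto
  then have "?F r \<le> ?F j"
    unfolding r_def split_search_def by (intro m(2)[OF lohi _ cv]) simp_all
  moreover have "2 * y - j = i" using ji by simp
  ultimately show "h (0, r) + h (2, 2 * y - r) \<le> h (0, j) + h (2, i)" by simp
qed

lemma slope_certs_supports:
  assumes h: "convex_grid n h" and n: "0 < n" "n \<le> 2 ^ L"
  obtains a c where "a < n" "c < n" "supports n (\<lambda>z. h (0, z)) a b" "supports n (\<lambda>z. h (2, z)) c b"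
    "Pair 0 ` set (dyadic n L a) \<union> Pair 2 ` set (dyadic n L c) \<subseteq> queried h (slope_certs n L b)"
proof (rule that)
  let ?a = "result h (slope_search n L 0 b)" and ?c = "result h (slope_search n L 2 b)"
  note cv = convex_grid_column[OF h]
  show "?a < n" "supports n (\<lambda>z. h (0, z)) ?a b"
    using slope_search_supports[OF cv n, of 0 b] by simp_all
  show "?c < n" "supports n (\<lambda>z. h (2, z)) ?c b"
    using slope_search_supports[OF cv n, of 2 b] by simp_all
  show "Pair 0 ` set (dyadic n L ?a) \<union> Pair 2 ` set (dyadic n L ?c) \<subseteq> queried h (slope_certs n L b)"
    by (auto simp: slope_certs_def)
qed

text \<open>Whichever candidate supplies the slope, its points of tangency in the outer columns have
  been certified.\<close>

lemma point_check_middle: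
  assumes h: "convex_grid n h" and y: "y < n" and L: "n \<le> 2 ^ L"
  obtains a c b where "a < n" "c < n" "mid_supports n h y b"
    "supports n (\<lambda>z. h (0, z)) a b" "supports n (\<lambda>z. h (2, z)) c b"
    "Pair 0 ` set (dyadic n L a) \<union> Pair 2 ` set (dyadic n L c) \<subseteq> queried h (point_check n L (1, y))"
proof -
  note goal = that
  let ?Q = "queried h (point_check n L (1, y))"
  have in_grid: "(1, y) \<in> grid n" using y by (simp add: grid_def)
  have Q: "queried h (split_certs n L y) \<subseteq> ?Q" "queried h (edge_certs n L y) \<subseteq> ?Q"
    "0 < y \<Longrightarrow> queried h (edge_certs n L (y - 1)) \<subseteq> ?Q"
    using in_grid by (auto simp: point_check_def)
  define r where "r = result h (split_search n L y)"
  note opt = split_search_optimal[OF h y L, folded r_def]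
  have sum: "r + (2 * y - r) = 2 * y" using opt(2) by simp
  obtain b where b: "mid_supports n h y b"
    "supports n (\<lambda>z. h (0, z)) r b \<and> supports n (\<lambda>z. h (2, z)) (2 * y - r) b
     \<or> y + 1 < n \<and> b = h (1, y + 1) - h (1, y)
     \<or> 0 < y \<and> b = h (1, y) - h (1, y - 1)"
    using mid_supports_candidate[OF h y opt(1,3) sum opt(4)] by blast
  have edge: thesis if "queried h (slope_certs n L b) \<subseteq> ?Q"
  proof -
    obtain a c where ac: "a < n" "c < n" "supports n (\<lambda>z. h (0, z)) a b" "supports n (\<lambda>z. h (2, z)) c b"
      "Pair 0 ` set (dyadic n L a) \<union> Pair 2 ` set (dyadic n L c) \<subseteq> queried h (slope_certs n L b)"
      using slope_certs_supports[OF h _ L, of b] y by auto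
    show thesis by (rule goal[OF ac(1,2) b(1) ac(3,4) order_trans[OF ac(5) that]])
  qed
  show thesis
    using b(2)
  proof (elim disjE conjE)
    assume s: "supports n (\<lambda>z. h (0, z)) r b" "supports n (\<lambda>z. h (2, z)) (2 * y - r) b"
    have "Pair 0 ` set (dyadic n L r) \<union> Pair 2 ` set (dyadic n L (2 * y - r))
        \<subseteq> queried h (split_certs n L y)"
      by (auto simp: split_certs_def r_def)
    then show thesis by (rule goal[OF opt(1,3) b(1) s order_trans[OF _ Q(1)]])
  next
    assume "y + 1 < n" "b = h (1, y + 1) - h (1, y)"
    then have "queried h (slope_certs n L b) \<subseteq> queried h (edge_certs n L y)"
      by (auto simp: edge_certs_def)
    then show thesis using edge Q(2) by blast
  next
    assume "0 < y" "b = h (1, y) - h (1, y - 1)"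
    then have "queried h (slope_certs n L b) \<subseteq> queried h (edge_certs n L (y - 1))"
      using y by (auto simp: edge_certs_def)
    then show thesis using edge Q(3) \<open>0 < y\<close> by blast
  qed
qed

section \<open>One convex function through all passing points\<close>

definition passes :: "nat \<Rightarrow> nat \<Rightarrow> (nat \<times> nat \<Rightarrow> real) \<Rightarrow> nat \<times> nat \<Rightarrow> bool" where
  "passes n L f x \<longleftrightarrow> (\<exists>h. convex_grid n h \<and> (\<forall>p\<in>queried f (point_check n L x). h p = f p))"

text \<open>The maximum of the supporting planes at the points of \<open>G\<close> is convex and
  touches \<open>f\<close> at each of them.\<close>

lemma convex_extension:
  assumes "G \<subseteq> grid n"
    and "\<And>x. x \<in> G \<Longrightarrow> \<exists>\<alpha> \<beta>. \<forall>z\<in>G.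
      f x + \<alpha> * (real (fst z) - real (fst x)) + \<beta> * (real (snd z) - real (snd x)) \<le> f z"
  obtains h where "convex_grid n h" "\<And>x. x \<in> G \<Longrightarrow> h x = f x"
proof (cases "G = {}")
  case True
  have "convex_grid n (\<lambda>_. 0)" by (rule convex_gridI) (auto intro!: exI[of _ 0])
  then show thesis using that True by blast
next
  case False
  have fin: "finite G" using assms(1) by (rule finite_subset) (simp add: grid_def)
  obtain \<alpha> \<beta> where ab: "\<And>x z. x \<in> G \<Longrightarrow> z \<in> G \<Longrightarrow>
      f x + \<alpha> x * (real (fst z) - real (fst x)) + \<beta> x * (real (snd z) - real (snd x)) \<le> f z"
    using assms(2) by metis
  define l where "l x z = f x + \<alpha> x * (real (fst z) - real (fst x)) + \<beta> x * (real (snd z) - real (snd x))" for x z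
  define h where "h z = Max ((\<lambda>x. l x z) ` G)" for z
  have ge: "l x z \<le> h z" if "x \<in> G" for x z
    unfolding h_def using fin that by (intro Max_ge) auto
  have "convex_grid n h"
  proof (rule convex_gridI)
    fix y
    have "h y \<in> (\<lambda>x. l x y) ` G" unfolding h_def using fin False by (intro Max_in) auto
    then obtain x where x: "x \<in> G" "h y = l x y" by blast
    show "\<exists>a b. \<forall>z\<in>grid n. h y + a * (real (fst z) - real (fst y)) + b * (real (snd z) - real (snd y)) \<le> h z"
    proof (intro exI ballI)
      fix z
      have "h y + \<alpha> x * (real (fst z) - real (fst y)) + \<beta> x * (real (snd z) - real (snd y)) = l x z"
        by (simp add: x(2) l_def algebra_simps)
      then show "h y + \<alpha> x * (real (fst z) - real (fst y)) + \<beta> x * (real (snd z) - real (snd y)) \<le> h z"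
        using ge[OF x(1)] by simp
    qed
  qed
  moreover have "h x = f x" if "x \<in> G" for x
  proof (rule antisym)
    show "h x \<le> f x" unfolding h_def using fin False ab that by (auto simp: l_def)
    show "f x \<le> h x" using ge[OF that, of x] by (simp add: l_def)
  qed
  ultimately show thesis by (rule that)
qed

text \<open>Every passing point has its own convex witness, and these may disagree. Certificates
  turn subgradients of the witnesses into supporting planes of \<open>f\<close> on the passing
  points, which \<open>convex_extension\<close> glues together.\<close>

lemma passes_extension:
  assumes L: "n \<le> 2 ^ L"
  obtains h where "convex_grid n h" "\<And>x. x \<in> grid n \<Longrightarrow> passes n L f x \<Longrightarrow> h x = f x"
proof -
  define G where "G = {x \<in> grid n. passes n L f x}"
  have finG: "finite G" by (rule finite_subset[of _ "grid n"]) (auto simp: G_def grid_def)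
  have cert_queried: "Pair (fst x) ` set (dyadic n L (snd x)) \<subseteq> queried f (point_check n L x)"
    if "x \<in> grid n" for x
    using that by (auto simp: point_check_def)
  have witness: "\<exists>v. convex_seq n v \<and> (\<forall>z\<in>set (dyadic n L a). v z = f (c, z))" if ca: "(c, a) \<in> G" for c a
  proof -
    obtain h where h: "convex_grid n h" "\<forall>p\<in>queried f (point_check n L (c, a)). h p = f p"
      using ca unfolding G_def passes_def by blast
    have "convex_seq n (\<lambda>z. h (c, z))"
      using that by (intro convex_grid_column[OF h(1)]) (auto simp: G_def grid_def)
    moreover have "\<forall>z\<in>set (dyadic n L a). h (c, z) = f (c, z)"
      using h(2) cert_queried[of "(c, a)"] that by (auto simp: G_def)
    ultimately show ?thesis by blast
  qed
  have transfer: "f (c, a) + b * (real a' - real a) \<le> f (c, a')"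
    if hyps: "(c, a') \<in> G" "a < n" "convex_grid n h" "c < 3" "\<forall>z\<in>set (dyadic n L a). h (c, z) = f (c, z)"
      "supports n (\<lambda>z. h (c, z)) a b" for c a a' b h
  proof -
    obtain v where v: "convex_seq n v" "\<forall>z\<in>set (dyadic n L a'). v z = f (c, z)"
      using witness[OF hyps(1)] by blast
    have a': "a' < n" using hyps(1) by (auto simp: G_def grid_def)
    show ?thesis
      by (rule certified_transfer[OF L hyps(2) a' convex_grid_column[OF hyps(3,4)] _ hyps(6) v(1)])
        (use hyps(5) v(2) in auto)
  qed
  have planes: "\<exists>\<alpha> \<beta>. \<forall>z\<in>G. f x + \<alpha> * (real (fst z) - real (fst x)) + \<beta> * (real (snd z) - real (snd x)) \<le> f z"
    if x: "x \<in> G" for x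
  proof -
    obtain c y where xc: "x = (c, y)" by (cases x)
    have c: "c < 3" and y: "y < n" using x by (auto simp: xc G_def grid_def)
    obtain h where h: "convex_grid n h" and hf: "\<forall>p\<in>queried f (point_check n L x). h p = f p"
      using x unfolding G_def passes_def by blast
    have hy: "\<forall>z\<in>set (dyadic n L y). h (c, z) = f (c, z)"
      using hf cert_queried[of x] x by (auto simp: G_def xc)
    have hx: "h x = f x" using hy dyadic_self[OF y, of L] by (simp add: xc)
    have Gcol: "fst z \<in> {0, 1, 2}" if "z \<in> G" for z using that by (auto simp: G_def grid_def)
    show ?thesis
    proof (cases "c = 1")
      case True
      \<comment> \<open>The check runs identically on \<open>h\<close> and \<open>f\<close>, so the
        points it certifies for the convex \<open>h\<close> are known for \<open>f\<close>.\<close>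
      have "queried h (point_check n L x) = queried f (point_check n L x)"
        using cong_queried[of f "point_check n L x" h] hf by blast
      then obtain a e b where ae: "a < n" "e < n" "mid_supports n h y b"
        "supports n (\<lambda>z. h (0, z)) a b" "supports n (\<lambda>z. h (2, z)) e b"
        "Pair 0 ` set (dyadic n L a) \<union> Pair 2 ` set (dyadic n L e) \<subseteq> queried f (point_check n L x)"
        using point_check_middle[OF h y L] by (metis True xc)
      have h0: "\<forall>z\<in>set (dyadic n L a). h (0, z) = f (0, z)" and h2: "\<forall>z\<in>set (dyadic n L e). h (2, z) = f (2, z)"
        using ae(6) hf by auto
      have e0: "h (0, a) = f (0, a)" and e2: "h (2, e) = f (2, e)"
        using h0 h2 dyadic_self ae(1,2) by auto
      have mid: "2 * f x + b * (real a + real e - 2 * real y) \<le> f (0, a) + f (2, e)"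
        using ae(1-3) hx unfolding mid_supports_def xc True e0[symmetric] e2[symmetric] by metis
      \<comment> \<open>The plane passes through the value at \<open>(0, a)\<close>; by
        \<open>mid\<close> it is then not above \<open>f\<close> at \<open>(2, e)\<close>.\<close>
      define \<alpha> where "\<alpha> = f x + b * (real a - real y) - f (0, a)"
      have "f x + \<alpha> * (real (fst z) - real (fst x)) + b * (real (snd z) - real (snd x)) \<le> f z" if z: "z \<in> G" for z
      proof -
        obtain s where zs: "z = (0, s) \<or> z = (1, s) \<or> z = (2, s)" using Gcol[OF z] by (cases z) auto
        then show ?thesis
        proof (elim disjE)
          assume z0: "z = (0, s)"
          then have "f (0, a) + b * (real s - real a) \<le> f (0, s)"
            using transfer[OF _ ae(1) h _ h0 ae(4)] z by simp
          then show ?thesis by (simp add: z0 \<alpha>_def xc True algebra_simps)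
        next
          assume z1: "z = (1, s)"
          then have "f (1, y) + b * (real s - real y) \<le> f (1, s)"
            using transfer[OF _ y h, of 1 s b] z ae(3) hy True by (simp add: mid_supports_def)
          then show ?thesis by (simp add: z1 xc True)
        next
          assume z2: "z = (2, s)"
          then have "f (2, e) + b * (real s - real e) \<le> f (2, s)"
            using transfer[OF _ ae(2) h _ h2 ae(5)] z by simp
          then show ?thesis using mid by (simp add: z2 \<alpha>_def xc True algebra_simps)
        qed
      qed
      then show ?thesis by blast
    next
      case False
      note cv = convex_grid_column[OF h c]
      obtain b where b: "supports n (\<lambda>z. h (c, z)) y b"
      proof (cases "y = 0")
        case True
        \<comment> \<open>If \<open>n = 1\<close>, then \<open>h (c, y + 1)\<close> lies off the
          grid, but every slope is a subgradient.\<close>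
        have "supports n (\<lambda>z. h (c, z)) y (h (c, y + 1) - h (c, y))"
          using True y by (intro supports_convex_seq[OF cv]) auto
        then show thesis by (rule that)
      qed (use secant_supports[OF cv _ y] that in auto)
      text \<open>An outer column is a face of the grid, so a steep enough slope away from it makes
        the plane lie below the other columns.\<close>
      define K where "K = Max (insert 0 ((\<lambda>z. \<bar>f x\<bar> + \<bar>b * (real (snd z) - real (snd x))\<bar> + \<bar>f z\<bar>) ` G))"
      have K: "\<bar>f x\<bar> + \<bar>b * (real (snd z) - real (snd x))\<bar> + \<bar>f z\<bar> \<le> K" if "z \<in> G" for z
        unfolding K_def using finG that by (intro Max_ge) auto
      have K0: "0 \<le> K" unfolding K_def using finG by (intro Max_ge) auto
      define \<alpha> where "\<alpha> = (if c = 0 then - K else K)"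
      have "f x + \<alpha> * (real (fst z) - real (fst x)) + b * (real (snd z) - real (snd x)) \<le> f z" if z: "z \<in> G" for z
      proof (cases "fst z = c")
        case True
        then have "(c, snd z) \<in> G" using z by (cases z) auto
        from transfer[OF this y h c hy b] show ?thesis using True by (cases z) (simp add: xc)
      next
        case False
        have "c = 0 \<or> c = 2" using c \<open>c \<noteq> 1\<close> by auto
        then have "\<alpha> * (real (fst z) - real (fst x)) \<le> - K"
          using Gcol[OF z] False K0 by (auto simp: \<alpha>_def xc)
        then show ?thesis using K[OF z] by linarith
      qed
      then show ?thesis by blast
    qed
  qed
  have "G \<subseteq> grid n" by (auto simp: G_def)
  from convex_extension[OF this planes] obtain h
    where h: "convex_grid n h" "\<And>x. x \<in> G \<Longrightarrow> h x = f x" by blast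
  show thesis by (rule that[OF h(1)]) (simp add: h(2) G_def)
qed

text \<open>The set \<open>H\<close> collects the answers; the run fails when no convex function is consistent
  with them, hence never on a convex input.\<close>

primrec prog_alg :: "nat \<Rightarrow> 'a prog \<Rightarrow> (nat \<times> nat \<times> real) set \<Rightarrow> alg \<Rightarrow> alg" where
  "prog_alg n (Ret x) H A =
     (if \<exists>h. convex_grid n h \<and> (\<forall>(i, j, v)\<in>H. h (i, j) = v) then A else Decide False)"
| "prog_alg n (Ask p k) H A = Query p (\<lambda>v. prog_alg n (k v) (insert (fst p, snd p, v) H) A)"

lemma budget_prog_alg:
  assumes "cost_le n P d" "budget n A q s"
  shows "budget n (prog_alg n P H A) (d + q) s"
  using assms(1)
proof (induction P arbitrary: d H)
  case (Ret x)
  then show ?case using assms(2) by (auto intro: budget.intros)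
next
  case (Ask p k)
  then obtain d' where d: "d = Suc d'" by (cases d) auto
  have "budget n (Query p (\<lambda>v. prog_alg n (k v) (insert (fst p, snd p, v) H) A)) (Suc (d' + q)) s"
    using Ask d by (intro budget.intros(2)) auto
  then show ?case by (simp add: d)
qed

lemma run_prog_alg:
  "run f D (prog_alg n P H A) =
     (if \<exists>h. convex_grid n h \<and> (\<forall>(i, j, v)\<in>H. h (i, j) = v) \<and> (\<forall>p\<in>queried f P. h p = f p)
      then run f D A else return_pmf False)"
  by (induction P arbitrary: H) (auto simp del: split_paired_Ex)

text \<open>Each sample starts from an empty answer set, so the rounds are independent and the
  acceptance probability is a power.\<close>

primrec tester :: "nat \<Rightarrow> nat \<Rightarrow> nat \<Rightarrow> alg" where
  "tester n L 0 = Decide True"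
| "tester n L (Suc m) = Sample (\<lambda>x. prog_alg n (point_check n L x) {} (tester n L m))"

lemma budget_tester: "budget n (tester n L m) (m * (40 * L + 32)) m"
proof (induction m)
  case (Suc m)
  have "budget n (tester n L (Suc m)) ((40 * L + 32) + m * (40 * L + 32)) (Suc m)"
    unfolding tester.simps by (intro budget.intros(3) budget_prog_alg cost_le_point_check Suc)
  then show ?case by simp
qed (simp add: budget.intros)

lemma pmf_run_tester:
  "pmf (run f D (tester n L m)) True = measure_pmf.prob D {x. passes n L f x} ^ m"
proof (induction m)
  case (Suc m)
  have "run f D (prog_alg n (point_check n L x) {} (tester n L m))
      = (if passes n L f x then run f D (tester n L m) else return_pmf False)" for x
    by (simp add: run_prog_alg passes_def)
  then have "pmf (run f D (tester n L (Suc m))) True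
      = measure_pmf.expectation D (\<lambda>x. indicator {x. passes n L f x} x * pmf (run f D (tester n L m)) True)"
    by (simp add: pmf_bind comp_def indicator_def del: Bochner_Integration.integral_mult_left_zero)
      (rule Bochner_Integration.integral_cong, auto)
  also have "\<dots> = measure_pmf.prob D {x. passes n L f x} * pmf (run f D (tester n L m)) True"
    by simp
  finally show ?case using Suc by simp
qed simp

text \<open>The function from \<open>passes_extension\<close> differs from \<open>f\<close> only at
  failing points of the grid, so these have mass at least \<open>\<epsilon>\<close>. All
  \<open>m\<close> samples miss them with probability at most \<open>exp (- 2)\<close>.\<close>

lemma tester_far:
  assumes L: "n \<le> 2 ^ L" and D: "set_pmf D \<subseteq> grid n" and \<epsilon>: "0 < \<epsilon>" "\<epsilon> < 1"
    and far: "far_dist n \<epsilon> D f" and m: "2 / \<epsilon> \<le> real m"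
  shows "2/3 \<le> pmf (run f D (tester n L m)) False"
proof -
  let ?A = "{x. passes n L f x}"
  obtain h where h: "convex_grid n h" "\<And>x. x \<in> grid n \<Longrightarrow> passes n L f x \<Longrightarrow> h x = f x"
    using passes_extension[OF L] by blast
  have "\<epsilon> \<le> measure_pmf.prob D {x. f x \<noteq> h x}" using far h(1) by (simp add: far_dist_def)
  also have "\<dots> \<le> measure_pmf.prob D (- ?A)"
  proof (rule measure_pmf.finite_measure_mono_AE)
    show "AE x in D. x \<in> {x. f x \<noteq> h x} \<longrightarrow> x \<in> - ?A"
      using D h(2) by (auto simp: AE_measure_pmf_iff)
  qed simp
  also have "\<dots> = 1 - measure_pmf.prob D ?A"
    using measure_pmf.prob_compl[of ?A D] by (simp add: Compl_eq_Diff_UNIV)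
  finally have "measure_pmf.prob D ?A \<le> 1 - \<epsilon>" by simp
  also have "\<dots> \<le> exp (- \<epsilon>)" using exp_ge_add_one_self[of "- \<epsilon>"] by simp
  finally have "measure_pmf.prob D ?A ^ m \<le> exp (- \<epsilon>) ^ m" by (intro power_mono) auto
  also have "\<dots> = exp (- (\<epsilon> * real m))" by (simp add: mult.commute flip: exp_of_nat_mult)
  also have "\<dots> \<le> exp (- 2)" using m \<epsilon> by (simp add: field_simps)
  also have "\<dots> \<le> 1/3" using exp_ge_add_one_self[of 2] by (simp add: exp_minus field_simps)
  finally have "pmf (run f D (tester n L m)) True \<le> 1/3" by (simp add: pmf_run_tester)
  then show ?thesis by (simp add: pmf_False_conv_True)
qed

lemma tester_complete:
  assumes "convex_grid n f"
  shows "pmf (run f D (tester n L m)) True = 1"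
proof -
  have "{x. passes n L f x} = UNIV" using assms by (auto simp: passes_def)
  then show ?thesis by (simp add: pmf_run_tester)
qed

section \<open>Logarithmic depth and the total budget\<close>

definition depth :: "nat \<Rightarrow> nat" where
  "depth n = nat \<lceil>log 2 (real n)\<rceil>"

lemma le_power_depth: "0 < n \<Longrightarrow> n \<le> 2 ^ depth n"
proof -
  assume n: "0 < n"
  have "real n = 2 powr log 2 (real n)" using n by simp
  also have "\<dots> \<le> 2 powr real (depth n)"
    by (intro powr_mono) (simp_all add: depth_def real_nat_ceiling_ge)
  also have "\<dots> = real (2 ^ depth n)" by (simp add: powr_realpow)
  finally show ?thesis using of_nat_le_iff by blast
qed

text \<open>From \<open>depth n \<le> 2 * ln n + 1\<close> the cost is at most
  \<open>80 * ln n + 72\<close>; as \<open>ln n \<ge> 1\<close> for \<open>n \<ge> 3\<close>, this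
  is at most \<open>152 * ln n\<close>.\<close>

lemma depth_bound:
  assumes "3 \<le> n"
  shows "real (40 * depth n + 32) \<le> 152 * (ln (real n))\<^sup>2"
proof -
  have "exp 1 \<le> (3::real)" by (rule exp_le)
  then have "exp 1 \<le> real n" using assms by linarith
  then have ln1: "1 \<le> ln (real n)" using assms by (subst ln_ge_iff) auto
  have l2: "1/2 \<le> ln (2::real)" using ln2_ge_two_thirds by linarith
  have "log 2 (real n) = ln (real n) / ln 2" by (simp add: log_def)
  also have "\<dots> \<le> ln (real n) / (1/2)" using ln1 l2 by (intro divide_left_mono) auto
  finally have "log 2 (real n) \<le> 2 * ln (real n)" by simp
  moreover have "0 \<le> log 2 (real n)" using assms by simp
  then have "real (depth n) \<le> log 2 (real n) + 1" unfolding depth_def by linarith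
  ultimately have "real (40 * depth n + 32) \<le> 152 * ln (real n)" using ln1 by simp
  also have "\<dots> \<le> 152 * (ln (real n))\<^sup>2"
    using mult_left_mono[OF ln1, of "ln (real n)"] ln1 by (simp add: power2_eq_square)
  finally show ?thesis .
qed

lemma budget_tester_depth:
  assumes n: "3 \<le> n" and \<epsilon>: "0 < \<epsilon>" "\<epsilon> < 1"
  shows "budget n (tester n (depth n) (nat \<lceil>2 / \<epsilon>\<rceil>))
    (nat \<lceil>456 * (ln (real n))\<^sup>2 / \<epsilon>\<rceil>) (nat \<lceil>456 / \<epsilon>\<rceil>)"
proof (rule budget.intros(5)[OF budget_tester])
  let ?m = "nat \<lceil>2 / \<epsilon>\<rceil>"
  have "1 \<le> 1 / \<epsilon>" using \<epsilon> by simp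
  \<comment> \<open>Rounding up adds at most \<open>1 \<le> 1 / \<epsilon>\<close>; the constant 456
    is \<open>3 * 152\<close>.\<close>
  then have m: "real ?m \<le> 3 / \<epsilon>" by linarith
  have "real (?m * (40 * depth n + 32)) \<le> 3 / \<epsilon> * (152 * (ln (real n))\<^sup>2)"
    unfolding of_nat_mult using m depth_bound[OF n] \<epsilon> by (intro mult_mono) auto
  also have "\<dots> = 456 * (ln (real n))\<^sup>2 / \<epsilon>" by simp
  finally show "?m * (40 * depth n + 32) \<le> nat \<lceil>456 * (ln (real n))\<^sup>2 / \<epsilon>\<rceil>" by linarith
  show "?m \<le> nat \<lceil>456 / \<epsilon>\<rceil>" using \<epsilon> by (intro nat_mono ceiling_mono divide_right_mono) auto
qed

section \<open>The non-adaptive lower bound\<close>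

text \<open>On the grid, \<open>yes_fun\<close> is a function of the linear form \<open>shear r\<close>, whose level sets are the
  collinear triples \<open>(0, y + r), (1, y), (2, y - r)\<close>. The label \<open>u\<close> perturbs a strictly convex
  parabola by less than its curvature, so \<open>yes_fun\<close> is convex, whereas raising the label in the
  middle column alone breaks midpoint convexity on every triple without wrap-around. With random
  labels, one query per triple has the same distribution under both.\<close>

definition shear :: "nat \<Rightarrow> nat \<times> nat \<Rightarrow> int" where
  "shear r p = int (snd p) + (int (fst p) - 1) * int r"

definition yes_fun :: "nat \<Rightarrow> nat \<Rightarrow> (int \<Rightarrow> nat) \<Rightarrow> nat \<times> nat \<Rightarrow> real" where
  "yes_fun n r u p = (if p \<in> grid n
     then (real_of_int (shear r p))\<^sup>2 + real (u (shear r p)) / 8 else 0)"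

definition no_fun :: "nat \<Rightarrow> nat \<Rightarrow> (int \<Rightarrow> nat) \<Rightarrow> nat \<times> nat \<Rightarrow> real" where
  "no_fun n r u p = (if p \<in> grid n
     then (real_of_int (shear r p))\<^sup>2
       + real (if fst p = 1 then Suc (u (shear r p)) mod 8 else u (shear r p)) / 8 else 0)"

text \<open>The interval contains all values of \<open>shear r\<close> for \<open>r < n\<close>;
  \<open>PiE\<close> keeps the set finite, so averages become cardinalities.\<close>

definition labels :: "nat \<Rightarrow> (int \<Rightarrow> nat) set" where
  "labels n = PiE {- int n..2 * int n} (\<lambda>_. {0..<8})"

lemma finite_labels: "finite (labels n)"
  unfolding labels_def by (intro finite_PiE) auto

lemma labels_nonempty: "labels n \<noteq> {}"
  unfolding labels_def by (auto simp: PiE_eq_empty_iff)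

lemma shear_in_range:
  assumes "p \<in> grid n" "r < n"
  shows "shear r p \<in> {- int n..2 * int n}"
proof -
  obtain c y where p: "p = (c, y)" by (cases p)
  have "c = 0 \<or> c = 1 \<or> c = 2" "y < n" using assms(1) by (auto simp: p grid_def)
  then show ?thesis using assms(2) by (auto simp: p shear_def)
qed

lemma labels_less_8:
  assumes "u \<in> labels n" "p \<in> grid n" "r < n"
  shows "u (shear r p) < 8"
  using PiE_mem[of u "{- int n..2 * int n}" "\<lambda>_. {0..<8}" "shear r p"] assms shear_in_range[of p n r]
  unfolding labels_def by auto

text \<open>The tangent of the parabola at \<open>s\<close> supports it. Distinct integers
  \<open>s\<close>, \<open>t\<close> leave a gap \<open>(t - s)\<^sup>2 \<ge> 1\<close>, which
  exceeds the perturbation \<open>u s / 8\<close>.\<close>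

lemma convex_yes_fun:
  assumes u: "u \<in> labels n" and r: "r < n"
  shows "convex_grid n (yes_fun n r u)"
proof (rule convex_gridI)
  fix y assume y: "y \<in> grid n"
  define s where "s = shear r y"
  show "\<exists>\<alpha> \<beta>. \<forall>x\<in>grid n. yes_fun n r u y + \<alpha> * (real (fst x) - real (fst y))
      + \<beta> * (real (snd x) - real (snd y)) \<le> yes_fun n r u x"
  proof (intro exI ballI)
    fix x assume x: "x \<in> grid n"
    define t where "t = shear r x"
    have "(real (snd x) - real (snd y)) + real r * (real (fst x) - real (fst y)) = of_int t - of_int s"
      unfolding s_def t_def shear_def by (simp add: algebra_simps)
    then have lin: "2 * of_int s * real r * (real (fst x) - real (fst y))
        + 2 * of_int s * (real (snd x) - real (snd y)) = 2 * of_int s * (of_int t - of_int s)"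
      by (metis (no_types, opaque_lifting) add.commute distrib_left mult.assoc)
    have "of_int s ^ 2 + real (u s) / 8 + 2 * of_int s * (of_int t - of_int s)
        \<le> of_int t ^ 2 + real (u t) / 8"
    proof (cases "t = s")
      case False
      then have "(t - s)\<^sup>2 \<ge> 1"
        by (metis int_one_le_iff_zero_less zero_less_power2 right_minus_eq)
      then have "real_of_int ((t - s)\<^sup>2) \<ge> 1" by linarith
      then have sq: "(of_int t - of_int s)\<^sup>2 \<ge> (1::real)" by simp
      have "u s < 8" using labels_less_8[OF u y r] by (simp add: s_def)
      then have "of_int s ^ 2 + real (u s) / 8 + 2 * of_int s * (of_int t - of_int s)
          \<le> of_int s ^ 2 + (of_int t - of_int s)\<^sup>2 + 2 * of_int s * (of_int t - of_int s)"
        using sq by simp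
      also have "\<dots> = (of_int t)\<^sup>2" by (simp add: power2_eq_square algebra_simps)
      finally show ?thesis by (simp add: add_increasing2)
    qed simp
    then show "yes_fun n r u y + (2 * of_int s * real r) * (real (fst x) - real (fst y))
        + (2 * of_int s) * (real (snd x) - real (snd y)) \<le> yes_fun n r u x"
      using x y lin by (simp add: yes_fun_def flip: s_def t_def)
  qed
qed

lemma convex_grid_midpoint:
  assumes "convex_grid n h" "(0, a) \<in> grid n" "(2, c) \<in> grid n" "(1, y) \<in> grid n" "a + c = 2 * y"
  shows "2 * h (1, y) \<le> h (0, a) + h (2, c)"
proof -
  have "real a + real c = 2 * real y" using assms(5) by linarith
  then show ?thesis
    using convex_grid_two_pairs[OF assms(1) _ _ _ assms(2,3) assms(2,3) assms(4), of 1 0] by simp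
qed

text \<open>A label below 7 puts the middle point \<open>1 / 8\<close> above its two equal
  neighbours, so \<open>h\<close> must change a point of that triple. Distinct triples are disjoint,
  and at least \<open>n / 4\<close> of them qualify, out of \<open>3 * n\<close> points.\<close>

lemma no_fun_far:
  assumes u: "u \<in> labels n" and r: "r < n div 4"
    and few: "2 * card {y \<in> {n div 4..<n - n div 4}. u (int y) = 7} \<le> n - 2 * (n div 4)"
  shows "far_unif n (1/12) (no_fun n r u)"
  unfolding far_unif_def
proof (intro allI impI)
  fix h assume h: "convex_grid n h"
  define m where "m = n div 4"
  define M where "M = {m..<n - m}"
  define B where "B = {y \<in> M. u (int y) \<noteq> 7}"
  define E where "E = {x \<in> grid n. no_fun n r u x \<noteq> h x}"
  have finE: "finite E" by (simp add: E_def grid_def)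
  have "\<exists>p\<in>E. shear r p = int y" if y: "y \<in> B" for y
  proof (rule ccontr)
    assume none: "\<not> ?thesis"
    have y1: "m \<le> y" "y < n - m" "u (int y) \<noteq> 7" using y by (auto simp: B_def M_def)
    \<comment> \<open>The margin \<open>m\<close> exceeds \<open>r\<close>, so the triple does not
      leave the grid.\<close>
    have in0: "(0, y + r) \<in> grid n" and in1: "(1, y) \<in> grid n" and in2: "(2, y - r) \<in> grid n"
      using y1 r by (auto simp: grid_def m_def)
    have s: "shear r (0, y + r) = int y" "shear r (1, y) = int y" "shear r (2, y - r) = int y"
      using y1 r by (auto simp: shear_def m_def)
    have eq: "no_fun n r u p = h p" if "p \<in> grid n" "shear r p = int y" for p
      using none that by (cases p) (auto simp: E_def)
    have "u (int y) < 8" using labels_less_8[OF u in1, of r] r s by simp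
    then have lt: "u (int y) < 7" using y1 by simp
    have "2 * h (1, y) \<le> h (0, y + r) + h (2, y - r)"
      using y1 r by (intro convex_grid_midpoint[OF h in0 in2 in1]) (simp add: m_def)
    then have "2 * no_fun n r u (1, y) \<le> no_fun n r u (0, y + r) + no_fun n r u (2, y - r)"
      using eq[OF in0 s(1)] eq[OF in1 s(2)] eq[OF in2 s(3)] by simp
    then show False using lt in0 in1 in2 s by (simp add: no_fun_def)
  qed
  then have "int ` B \<subseteq> shear r ` E" by force
  then have "card (int ` B) \<le> card E"
    by (metis card_image_le card_mono finE finite_imageI le_trans)
  then have BE: "card B \<le> card E" by (simp add: card_image)
  have "card M = card {y \<in> M. u (int y) = 7} + card B"
  proof -
    have "M = {y \<in> M. u (int y) = 7} \<union> B" by (auto simp: B_def)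
    moreover have "finite M" by (simp add: M_def)
    ultimately show ?thesis
      by (metis (no_types, lifting) B_def card_Un_disjoint disjoint_iff finite_Un mem_Collect_eq)
  qed
  moreover have "card M = n - 2 * m" by (simp add: M_def)
  moreover have "2 * card {y \<in> M. u (int y) = 7} \<le> n - 2 * m" using few by (simp add: M_def m_def)
  moreover have "2 * (n - 2 * m) \<ge> n" unfolding m_def by linarith
  ultimately have "4 * card E \<ge> n" using BE by linarith
  then have "real n \<le> 4 * real (card E)" by linarith
  moreover have "card (grid n) = 3 * n" by (simp add: grid_def)
  ultimately show "1/12 * real (card (grid n)) \<le> real (card {x \<in> grid n. no_fun n r u x \<noteq> h x})"
    unfolding E_def by simp
qed

section \<open>Counting labels\<close>

lemma card_PiE_fixed_value:
  assumes "finite I" "i \<in> I" "a \<in> A"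
  shows "card A * card {u \<in> PiE I (\<lambda>_. A). u i = a} = card (PiE I (\<lambda>_. A))"
proof -
  have "{u \<in> PiE I (\<lambda>_. A). u i = a} = PiE I (\<lambda>k. if k = i then {a} else A)"
    using assms by (auto simp: PiE_iff extensional_def) (metis singletonD)+
  then have "card {u \<in> PiE I (\<lambda>_. A). u i = a} = (\<Prod>k\<in>I. card (if k = i then {a} else A))"
    using assms(1) by (simp add: card_PiE)
  also have "\<dots> = card {a} * (\<Prod>k\<in>I - {i}. card (if k = i then {a} else A))"
    using prod.remove[OF assms(1,2), of "\<lambda>k. card (if k = i then {a} else A)"] by simp
  also have "(\<Prod>k\<in>I - {i}. card (if k = i then {a} else A)) = (\<Prod>k\<in>I - {i}. card A)"
    by (intro prod.cong) auto
  finally have "card A * card {u \<in> PiE I (\<lambda>_. A). u i = a} = card A * (\<Prod>k\<in>I - {i}. card A)"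
    by simp
  also have "\<dots> = (\<Prod>k\<in>I. card A)"
    using assms by (intro prod.remove[symmetric]) auto
  also have "\<dots> = card (PiE I (\<lambda>_. A))"
    using assms(1) by (simp add: card_PiE)
  finally show ?thesis .
qed

lemma card_labels_eq_7:
  assumes "i \<in> {- int n..2 * int n}"
  shows "8 * card {u \<in> labels n. u i = 7} = card (labels n)"
  using card_PiE_fixed_value[OF _ assms, of "7::nat" "{0..<8}"] by (simp add: labels_def)

text \<open>Markov's inequality by double counting: on average one eighth of the labels equal 7, so
  more than half do with probability at most \<open>1 / 4\<close>.\<close>

lemma card_labels_many_7:
  "4 * card {u \<in> labels n. \<not> 2 * card {y \<in> {n div 4..<n - n div 4}. u (int y) = 7} \<le> n - 2 * (n div 4)}
     \<le> card (labels n)" (is "4 * card ?W \<le> _")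
proof -
  define M where "M = {n div 4..<n - n div 4}"
  define k where "k = n - 2 * (n div 4)"
  have cM: "card M = k" and finite_M: "finite M" by (simp_all add: M_def k_def)
  have "card ?W * k \<le> (\<Sum>u\<in>?W. 2 * card {y \<in> M. u (int y) = 7})"
    using sum_mono[of ?W "\<lambda>_. k" "\<lambda>u. 2 * card {y \<in> M. u (int y) = 7}"] by (auto simp: M_def k_def)
  also have "\<dots> \<le> (\<Sum>u\<in>labels n. 2 * card {y \<in> M. u (int y) = 7})"
    by (intro sum_mono2 finite_labels) auto
  also have "\<dots> = 2 * (\<Sum>u\<in>labels n. \<Sum>y\<in>M. of_bool (u (int y) = 7))"
    using finite_M by (simp add: sum_distrib_left Collect_conj_eq Int_commute)
  also have "\<dots> = 2 * (\<Sum>y\<in>M. card {u \<in> labels n. u (int y) = 7})"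
    using finite_labels by (subst sum.swap) (simp add: Collect_conj_eq Int_commute)
  finally have "4 * (card ?W * k) \<le> 8 * (\<Sum>y\<in>M. card {u \<in> labels n. u (int y) = 7})"
    by linarith
  also have "\<dots> = (\<Sum>y\<in>M. 8 * card {u \<in> labels n. u (int y) = 7})"
    by (rule sum_distrib_left)
  also have "\<dots> = (\<Sum>y\<in>M. card (labels n))"
    by (intro sum.cong refl card_labels_eq_7) (auto simp: M_def)
  finally have *: "4 * card ?W * k \<le> card (labels n) * k" by (simp add: cM mult.commute)
  show ?thesis
  proof (cases "k = 0")
    case True
    then have "M = {}" using cM by (simp add: M_def)
    then have "?W = {}" by (auto simp flip: M_def)
    then show ?thesis by (metis card.empty mult_0_right le0)
  next
    case False
    then show ?thesis using * by simp
  qed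
qed

text \<open>Shifting the labels cyclically on the levels \<open>J\<close> seen in the middle column
  permutes \<open>labels n\<close>. Without collisions no outer query meets \<open>J\<close>, so the
  shift turns the answers of \<open>no_fun\<close> into those of \<open>yes_fun\<close>.\<close>

lemma no_collision_same_count:
  assumes r: "r < n"
    and nc: "\<And>p p'. p \<in> set qs \<Longrightarrow> p' \<in> set qs \<Longrightarrow> p \<in> grid n \<Longrightarrow> p' \<in> grid n \<Longrightarrow>
               fst p = 1 \<Longrightarrow> fst p' \<noteq> 1 \<Longrightarrow> shear r p \<noteq> shear r p'"
  shows "card {u \<in> labels n. dec (map (no_fun n r u) qs)} = card {u \<in> labels n. dec (map (yes_fun n r u) qs)}"
proof -
  define J where "J = {shear r p | p. p \<in> set qs \<and> p \<in> grid n \<and> fst p = 1}"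
  define \<Phi> where "\<Phi> u = (\<lambda>s. if s \<in> J then Suc (u s) mod 8 else u s)" for u :: "int \<Rightarrow> nat"
  let ?I = "{- int n..2 * int n}"
  have J: "J \<subseteq> ?I" unfolding J_def using shear_in_range r by blast
  have maps: "\<Phi> u \<in> labels n" if "u \<in> labels n" for u
    unfolding labels_def
  proof (rule PiE_I)
    fix s assume "s \<in> ?I"
    then have "u s < 8" using that by (auto simp: labels_def PiE_iff)
    then show "\<Phi> u s \<in> {0..<8}" by (simp add: \<Phi>_def)
  next
    fix s assume "s \<notin> ?I"
    then show "\<Phi> u s = undefined"
      using that J PiE_arb[of u ?I _ s] by (auto simp: labels_def \<Phi>_def)
  qed
  have inj: "inj_on \<Phi> (labels n)"
  proof (rule inj_onI, rule ext)
    fix u v s assume u: "u \<in> labels n" "v \<in> labels n" and e: "\<Phi> u = \<Phi> v"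
    have s: "\<Phi> u s = \<Phi> v s" using e by simp
    show "u s = v s"
    proof (cases "s \<in> J")
      case True
      then have "u s < 8" "v s < 8" using u J by (auto simp: labels_def PiE_iff)
      moreover have "Suc (u s) mod 8 = Suc (v s) mod 8" using s True by (simp add: \<Phi>_def)
      ultimately show ?thesis by (simp add: mod_Suc split: if_splits)
    qed (use s in \<open>simp add: \<Phi>_def\<close>)
  qed
  have surj: "\<Phi> ` labels n = labels n"
    using maps inj finite_labels by (intro endo_inj_surj) auto
  have same: "map (yes_fun n r (\<Phi> u)) qs = map (no_fun n r u) qs" for u
  proof (rule map_cong[OF refl])
    fix p assume p: "p \<in> set qs"
    show "yes_fun n r (\<Phi> u) p = no_fun n r u p"
    proof (cases "p \<in> grid n")
      case True
      have "shear r p \<in> J \<longleftrightarrow> fst p = 1"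
      proof
        assume "shear r p \<in> J"
        then obtain p' where "p' \<in> set qs" "p' \<in> grid n" "fst p' = 1" "shear r p' = shear r p"
          unfolding J_def by auto
        then show "fst p = 1" using nc[OF _ p _ True] by metis
      qed (use p True in \<open>auto simp: J_def simp del: split_paired_Ex\<close>)
      then show ?thesis by (simp add: yes_fun_def no_fun_def \<Phi>_def)
    qed (simp add: yes_fun_def no_fun_def)
  qed
  have "{u \<in> labels n. dec (map (yes_fun n r u) qs)} = \<Phi> ` {u \<in> labels n. dec (map (no_fun n r u) qs)}"
  proof (intro set_eqI iffI)
    fix v assume v: "v \<in> {u \<in> labels n. dec (map (yes_fun n r u) qs)}"
    then obtain u where "u \<in> labels n" "v = \<Phi> u" using surj by blast
    then show "v \<in> \<Phi> ` {u \<in> labels n. dec (map (no_fun n r u) qs)}" using v same[of u] by auto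
  next
    fix v assume "v \<in> \<Phi> ` {u \<in> labels n. dec (map (no_fun n r u) qs)}"
    then obtain u where "u \<in> labels n" "dec (map (no_fun n r u) qs)" "v = \<Phi> u" by blast
    then show "v \<in> {u \<in> labels n. dec (map (yes_fun n r u) qs)}"
      using maps by (simp add: same del: map_eq_conv)
  qed
  moreover have "inj_on \<Phi> {u \<in> labels n. dec (map (no_fun n r u) qs)}"
    by (rule inj_on_subset[OF inj]) blast
  ultimately show ?thesis by (simp only: card_image)
qed

text \<open>A collision forces \<open>r\<close> to be the distance of the second coordinates, so
  each pair of queries spoils at most one \<open>r\<close>.\<close>

lemma card_collisions:
  fixes qs :: "(nat \<times> nat) list" and n :: nat
  defines "Bad \<equiv> {r. \<exists>p\<in>set qs. \<exists>p'\<in>set qs. p \<in> grid n \<and> p' \<in> grid n \<and> fst p = 1 \<and> fst p' \<noteq> 1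
    \<and> shear r p = shear r p'}"
  shows "finite Bad" "card Bad \<le> (length qs)\<^sup>2"
proof -
  let ?g = "\<lambda>(p, p'). nat \<bar>int (snd p) - int (snd p')\<bar>"
  have "Bad \<subseteq> ?g ` (set qs \<times> set qs)"
  proof
    fix r assume "r \<in> Bad"
    then obtain p p' where p: "p \<in> set qs" "p' \<in> set qs" "p' \<in> grid n" "fst p = 1" "fst p' \<noteq> 1"
      "shear r p = shear r p'" by (auto simp: Bad_def)
    have "fst p' = 0 \<or> fst p' = 2" using p by (auto simp: grid_def)
    then have "r = ?g (p, p')" using p by (auto simp: shear_def)
    then show "r \<in> ?g ` (set qs \<times> set qs)" using p by blast
  qed
  then show "finite Bad" by (rule finite_subset) simp
  have "card Bad \<le> card (set qs \<times> set qs)"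
    using \<open>Bad \<subseteq> _\<close> by (intro surj_card_le) auto
  also have "\<dots> \<le> (length qs)\<^sup>2"
    by (simp add: card_cartesian_product power2_eq_square card_length mult_mono)
  finally show "card Bad \<le> (length qs)\<^sup>2" .
qed

text \<open>Exchanging the average over inputs with the randomness of the tester reduces the bound
  to a fixed query list, as in Yao's principle.\<close>

lemma expectation_na_accept:
  assumes "finite (S :: 'a set)"
  shows "(\<Sum>s\<in>S. na_accept_prob T (F s))
    = measure_pmf.expectation T (\<lambda>(qs, dec). real (card {s \<in> S. dec (map (F s) qs)}))"
proof -
  have "na_accept_prob T (F s) = measure_pmf.expectation T (\<lambda>(qs, dec). of_bool (dec (map (F s) qs)))" for s
  proof -
    have "(\<lambda>(qs, dec). of_bool (dec (map (F s) qs))) = (indicator {(qs, dec). dec (map (F s) qs)} :: _ \<Rightarrow> real)"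
      by (auto simp: fun_eq_iff indicator_def)
    then show ?thesis by (simp add: na_accept_prob_def)
  qed
  then have "(\<Sum>s\<in>S. na_accept_prob T (F s))
      = (\<Sum>s\<in>S. measure_pmf.expectation T (\<lambda>(qs, dec). of_bool (dec (map (F s) qs))))" by simp
  also have "\<dots> = measure_pmf.expectation T (\<lambda>x. \<Sum>s\<in>S. case x of (qs, dec) \<Rightarrow> of_bool (dec (map (F s) qs)))"
    by (intro Bochner_Integration.integral_sum[symmetric] measure_pmf.integrable_const_bound[where B=1]) auto
  also have "\<dots> = measure_pmf.expectation T (\<lambda>(qs, dec). real (card {s \<in> S. dec (map (F s) qs)}))"
    using assms by (intro Bochner_Integration.integral_cong) (auto simp: Collect_conj_eq Int_commute)
  finally show ?thesis .
qed

text \<open>Average acceptance is at least \<open>2/3\<close> on \<open>yes_fun\<close> and at most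
  \<open>1/2\<close> on \<open>no_fun\<close>; only collisions can explain the gap of
  \<open>1/6\<close>. This gives \<open>q\<^sup>2 \<ge> (n div 4) / 6 \<ge> n / 48\<close>, and
  \<open>48 \<le> 7\<^sup>2\<close>.\<close>

lemma na_lower_bound:
  assumes n: "n \<ge> 4" and T: "na_tester n (1/12) T" and q: "na_queries_le T q"
  shows "real q \<ge> 1/7 * sqrt (real n)"
proof -
  define R where "R = {..<n div 4}"
  define U where "U = labels n"
  define S where "S = R \<times> U"
  have finS: "finite S" "finite U" "finite R" by (simp_all add: S_def R_def U_def finite_labels)
  let ?yes = "\<lambda>s. yes_fun n (fst s) (snd s)" and ?no = "\<lambda>s. no_fun n (fst s) (snd s)"
  let ?cy = "\<lambda>(qs, dec). real (card {s \<in> S. dec (map (?yes s) qs)})"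
  let ?cn = "\<lambda>(qs, dec). real (card {s \<in> S. dec (map (?no s) qs)})"
  have lb: "2/3 * real (card S) \<le> (\<Sum>s\<in>S. na_accept_prob T (?yes s))"
  proof -
    have "2/3 \<le> na_accept_prob T (?yes s)" if "s \<in> S" for s
      using that T convex_yes_fun[of "snd s" n "fst s"]
      by (auto simp: na_tester_def S_def R_def U_def)
    from sum_mono[OF this] show ?thesis by (simp add: mult.commute)
  qed
  define W where "W = {u \<in> U. \<not> 2 * card {y \<in> {n div 4..<n - n div 4}. u (int y) = 7} \<le> n - 2 * (n div 4)}"
  have W: "4 * real (card W) \<le> real (card U)"
    using card_labels_many_7[of n] unfolding W_def U_def by linarith
  have ub: "(\<Sum>s\<in>S. na_accept_prob T (?no s)) \<le> 1/2 * real (card S)"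
  proof -
    \<comment> \<open>Labels in \<open>W\<close> may fail to give far functions; they are at most a
      quarter, and \<open>1/3 + 2/3 * 1/4 = 1/2\<close>.\<close>
    have "na_accept_prob T (?no s) \<le> 1/3 + 2/3 * of_bool (snd s \<in> W)" if s: "s \<in> S" for s
    proof (cases "snd s \<in> W")
      case True
      then show ?thesis by (simp add: na_accept_prob_def)
    next
      case False
      then have "far_unif n (1/12) (?no s)"
        using s no_fun_far[of "snd s" n "fst s"] by (auto simp: S_def R_def U_def W_def)
      then show ?thesis using T False by (force simp: na_tester_def)
    qed
    from sum_mono[OF this] have "(\<Sum>s\<in>S. na_accept_prob T (?no s))
       \<le> real (card S) / 3 + 2/3 * (\<Sum>s\<in>S. of_bool (snd s \<in> W))"
      by (simp add: sum.distrib sum_distrib_left)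
    also have "(\<Sum>s\<in>S. of_bool (snd s \<in> W)) = real (card (R \<times> W))"
      using finS by (simp add: Collect_conj_eq) (rule arg_cong[where f=card], auto simp: S_def W_def)
    also have "\<dots> \<le> real (card S) / 4"
      using mult_left_mono[OF W, of "real (card R)"] by (simp add: S_def card_cartesian_product)
    finally show ?thesis by simp
  qed
  have int: "integrable (measure_pmf T) ?cy" "integrable (measure_pmf T) ?cn"
    by (rule measure_pmf.integrable_const_bound[where B="real (card S)"];
        auto intro!: card_mono finS)+
  \<comment> \<open>For a fixed query list the counts agree for every \<open>r\<close> outside
    \<open>Bad\<close>; each bad \<open>r\<close> contributes at most \<open>card U\<close>.\<close>
  have diff: "?cy x - ?cn x \<le> real (q\<^sup>2 * card U)" if "x \<in> set_pmf T" for x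
  proof -
    obtain qs dec where x: "x = (qs, dec)" by (cases x)
    have len: "length qs \<le> q" using q that by (auto simp: na_queries_le_def x)
    define Bad where "Bad = {r. \<exists>p\<in>set qs. \<exists>p'\<in>set qs. p \<in> grid n \<and> p' \<in> grid n \<and> fst p = 1 \<and> fst p' \<noteq> 1
      \<and> shear r p = shear r p'}"
    have cBad: "card Bad \<le> q\<^sup>2" and fBad: "finite Bad"
      using card_collisions[of qs n] len unfolding Bad_def
      by (auto intro: order_trans power_mono)
    have split: "card {s \<in> S. P (fst s) (snd s)} = (\<Sum>r\<in>R. card {u \<in> U. P r u})" for P
    proof -
      have "{s \<in> S. P (fst s) (snd s)} = (SIGMA r:R. {u \<in> U. P r u})" by (auto simp: S_def)
      then show ?thesis using finS by simp
    qed
    have "card {u \<in> U. dec (map (yes_fun n r u) qs)}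
        \<le> card {u \<in> U. dec (map (no_fun n r u) qs)} + (if r \<in> Bad then card U else 0)" if r: "r \<in> R" for r
    proof (cases "r \<in> Bad")
      case True
      then show ?thesis using finS by (simp add: card_mono trans_le_add2)
    next
      case False
      have "card {u \<in> labels n. dec (map (no_fun n r u) qs)} = card {u \<in> labels n. dec (map (yes_fun n r u) qs)}"
      proof (rule no_collision_same_count)
        show "r < n" using r by (simp add: R_def)
      qed (use False in \<open>unfold Bad_def, blast+\<close>)
      then show ?thesis by (simp add: U_def)
    qed
    from sum_mono[OF this]
    have "card {s \<in> S. dec (map (?yes s) qs)} \<le> card {s \<in> S. dec (map (?no s) qs)}
        + (\<Sum>r\<in>R. if r \<in> Bad then card U else 0)"
      by (simp add: split[of "\<lambda>r u. dec (map (yes_fun n r u) qs)"]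
        split[of "\<lambda>r u. dec (map (no_fun n r u) qs)"] sum.distrib)
    also have "(\<Sum>r\<in>R. if r \<in> Bad then card U else 0) = card (R \<inter> Bad) * card U"
      using finS by (simp add: sum.If_cases)
    also have "\<dots> \<le> q\<^sup>2 * card U"
      using cBad fBad by (intro mult_right_mono) (auto intro: order_trans[OF card_mono])
    finally show ?thesis unfolding x prod.case by linarith
  qed
  have "measure_pmf.expectation T (\<lambda>x. ?cy x - ?cn x) \<le> real (q\<^sup>2 * card U)"
    by (rule measure_pmf.integral_le_const[OF Bochner_Integration.integrable_diff[OF int]])
      (use diff in \<open>simp only: AE_measure_pmf_iff, blast\<close>)
  then have "(\<Sum>s\<in>S. na_accept_prob T (?yes s)) - (\<Sum>s\<in>S. na_accept_prob T (?no s)) \<le> real (q\<^sup>2 * card U)"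
    by (simp only: expectation_na_accept[OF finS(1)] Bochner_Integration.integral_diff[OF int])
  then have "1/6 * real (card S) \<le> real (q\<^sup>2 * card U)" using lb ub by linarith
  then have "(1/6 * real (card R)) * real (card U) \<le> real (q\<^sup>2) * real (card U)"
    by (simp add: S_def card_cartesian_product)
  moreover have "real (card U) > 0"
    using labels_nonempty finS by (simp add: U_def card_gt_0_iff)
  ultimately have q6: "1/6 * real (card R) \<le> real (q\<^sup>2)" by (rule mult_right_le_imp_le)
  have "n div 4 \<ge> 1" using n by simp
  then have "8 * (n div 4) \<ge> n" by linarith
  then have "real n \<le> 8 * real (card R)" unfolding R_def card_lessThan by linarith
  then have "real n \<le> (7 * real q)\<^sup>2" using q6 by (simp add: power_mult_distrib)
  then have "sqrt (real n) \<le> 7 * real q" by (intro real_le_lsqrt) auto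
  then show ?thesis by simp
qed

theorem theorem1p5:
  shows "(\<exists>C>0. \<exists>N0. \<exists>A :: nat \<Rightarrow> real \<Rightarrow> alg.
            \<forall>n\<ge>N0. \<forall>\<epsilon>. 0 < \<epsilon> \<and> \<epsilon> < 1 \<longrightarrow>
              budget n (A n \<epsilon>) (nat \<lceil>C * (ln (real n))\<^sup>2 / \<epsilon>\<rceil>) (nat \<lceil>C / \<epsilon>\<rceil>) \<and>
              (\<forall>f D. set_pmf D \<subseteq> grid n \<longrightarrow>
                 (convex_grid n f \<longrightarrow> pmf (run f D (A n \<epsilon>)) True = 1) \<and>
                 (far_dist n \<epsilon> D f \<longrightarrow> pmf (run f D (A n \<epsilon>)) False \<ge> 2/3)))
       \<and>
         (\<exists>\<epsilon>0>0. \<exists>c>0. \<exists>N0. \<forall>n\<ge>N0. \<forall>T q.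
            na_tester n \<epsilon>0 T \<and> na_queries_le T q \<longrightarrow> real q \<ge> c * sqrt (real n))"
proof
  define A where "A n \<epsilon> = tester n (depth n) (nat \<lceil>2 / \<epsilon>\<rceil>)" for n and \<epsilon> :: real
  have "\<forall>n\<ge>3. \<forall>\<epsilon>. 0 < \<epsilon> \<and> \<epsilon> < 1 \<longrightarrow>
      budget n (A n \<epsilon>) (nat \<lceil>456 * (ln (real n))\<^sup>2 / \<epsilon>\<rceil>) (nat \<lceil>456 / \<epsilon>\<rceil>) \<and>
      (\<forall>f D. set_pmf D \<subseteq> grid n \<longrightarrow>
         (convex_grid n f \<longrightarrow> pmf (run f D (A n \<epsilon>)) True = 1) \<and>
         (far_dist n \<epsilon> D f \<longrightarrow> pmf (run f D (A n \<epsilon>)) False \<ge> 2/3))"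
  proof (intro allI impI conjI; (elim conjE)?)
    fix n and \<epsilon> :: real and f D
    assume "3 \<le> n" "0 < \<epsilon>" "\<epsilon> < 1" "set_pmf D \<subseteq> grid n" "far_dist n \<epsilon> D f"
    then show "2/3 \<le> pmf (run f D (A n \<epsilon>)) False"
      unfolding A_def by (intro tester_far le_power_depth) (auto simp: real_nat_ceiling_ge)
  qed (simp_all add: A_def budget_tester_depth tester_complete)
  then show "\<exists>C>0. \<exists>N0. \<exists>A :: nat \<Rightarrow> real \<Rightarrow> alg.
            \<forall>n\<ge>N0. \<forall>\<epsilon>. 0 < \<epsilon> \<and> \<epsilon> < 1 \<longrightarrow>
              budget n (A n \<epsilon>) (nat \<lceil>C * (ln (real n))\<^sup>2 / \<epsilon>\<rceil>) (nat \<lceil>C / \<epsilon>\<rceil>) \<and>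
              (\<forall>f D. set_pmf D \<subseteq> grid n \<longrightarrow>
                 (convex_grid n f \<longrightarrow> pmf (run f D (A n \<epsilon>)) True = 1) \<and>
                 (far_dist n \<epsilon> D f \<longrightarrow> pmf (run f D (A n \<epsilon>)) False \<ge> 2/3))"
    by (intro exI[of _ 456] conjI exI[of _ 3] exI[of _ A]) auto
  show "\<exists>\<epsilon>0>0. \<exists>c>0. \<exists>N0. \<forall>n\<ge>N0. \<forall>T q.
            na_tester n \<epsilon>0 T \<and> na_queries_le T q \<longrightarrow> real q \<ge> c * sqrt (real n)"
    using na_lower_bound by (intro exI[of _ "1/12"] conjI exI[of _ "1/7"] exI[of _ 4]) auto
qed

end
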